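(* Let $U\subseteq\mathbb{R}^3$ be an open set and let $H,C,\nu\in C^\infty(U,\mathbb{R})$ be smooth real functions such that $H$ and $C$ are functionally independent on an open subset $V\subseteq U$. Consider the dynamical system $$\dot u=\nu(u)\,(\nabla H(u)\times\nabla C(u)),\qquad u\in U. \qquad (\ast)$$ Suppose $\Gamma\subset V$ is a periodic orbit of $(\ast)$, and suppose $\Gamma\subseteq (H,C)^{-1}(\{(h,c)\})$, where $(h,c)\in\mathbb{R}^2$ is a regular value of the map $(H,C):U\to\mathbb{R}^2$. Then the following hold. 1. If $c$ is a regular value of the map $C:U\to\mathbb{R}$, then for every smooth function $\alpha\in C^\infty(V,(0,\infty))$: (a) $\Gamma$, as a periodic orbit of the perturbed system $$\dot u=\nu(u)\,(\nabla H(u)\times\nabla C(u))-\alpha(u)\,(H(u)-h)\,\bigl[\nabla C(u)\times(\nabla H(u)\times\nabla C(u))\bigr],\qquad u\in V,$$ is orbitally phase asymptotically stable, with respect to perturbations in $V$, along the invariant manifold $C^{-1}(\{c\})$. (b) $\Gamma$, as a periodic orbit of the perturbed system $$\dot u=\nu(u)\,(\nabla H(u)\times\nabla C(u))+\alpha(u)\,(H(u)-h)\,\bigl[\nabla C(u)\times(\nabla H(u)\times\nabla C(u))\bigr],\qquad u\in V,$$ is unstable. 2. For every pair of smooth functions $\alpha,\beta\in C^\infty(V,(0,\infty))$: (a) $\Gamma$, as a periodic orbit of the perturbed system $$\dot u=\nu(u)\,(\nabla H(u)\times\nabla C(u))-\alpha(u)\,(H(u)-h)\,\bigl[\nabla C(u)\times(\nabla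 H(u)\times\nabla C(u))\bigr]+\beta(u)\,(C(u)-c)\,\bigl[\nabla H(u)\times(\nabla H(u)\times\nabla C(u))\bigr],\qquad u\in V,$$ is orbitally phase asymptotically stable, with respect to perturbations in $V$. (b) $\Gamma$ is unstable, as a periodic orbit of the perturbed system obtained from the system in 2(a) by changing the sign in front of $\alpha$ or $\beta$.
   Context: $\nabla$ is the Euclidean gradient, $\times$ the cross product in $\mathbb{R}^3$, and $\operatorname{dist}$ the Euclidean distance. "Functionally independent on $V$" means that $\nabla H(u)$ and $\nabla C(u)$ are linearly independent for every $u\in V$. The system $(\ast)$ is a (locally generic) three-dimensional Hamiltonian system: it is the Hamiltonian system with Hamiltonian $H$ on the Poisson manifold $(U,\Pi_{\nu,C})$, where $\Pi_{\nu,C}=\nu\bigl(\partial_xC\,\partial_y\wedge\partial_z+\partial_yC\,\partial_z\wedge\partial_x+\partial_zC\,\partial_x\wedge\partial_y\bigr)$ and $C$ is a Casimir function. A periodic orbit is the image $\Gamma=\{\gamma(t):0\le t\le T\}$ of a nonconstant $T$-periodic solution $\gamma$, $T>0$. Stability notions. Let $\dot x=X(x)$ be generated by a smooth vector field on an open set $W$, let $\Gamma=\{\gamma(t):0\le t\le T\}$ be a $T$-periodic orbit, and let $t\mapsto x(t;x_0)$ be the solution with $x(0)=x_0$. - $\Gamma$ is orbitally stable if for every $\varepsilon>0$ there is $\delta>0$ such that $\operatorname{dist}(x(t;x_0),\Gamma)<\varepsilon$ for all $t>0$ and all $x_0\in W$ with $\operatorname{dist}(x_0,\Gamma)<\delta$.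 - $\Gamma$ is unstable if it is not orbitally stable. - $\Gamma$ is orbitally asymptotically stable if it is orbitally stable and (choosing $\delta$ smaller if necessary) $\operatorname{dist}(x(t;x_0),\Gamma)\to0$ as $t\to\infty$ for all $x_0\in W$ with $\operatorname{dist}(x_0,\Gamma)<\delta$. - $\Gamma$ is orbitally phase asymptotically stable if it is orbitally asymptotically stable and there is $\delta>0$ such that for each $x_0\in W$ with $\operatorname{dist}(x_0,\Gamma)<\delta$ there exists $\theta_0=\theta_0(x_0)$ with $\lim_{t\to\infty}\operatorname{dist}(x(t;x_0),\gamma(t+\theta_0))=0$. "With respect to perturbations in $V$" means these definitions are applied with $x_0$ ranging over $W=V$. "With respect to perturbations in $V$, along the invariant manifold $M$" means they are applied to the restriction of the system to the dynamically invariant set $M\cap V$, i.e. with $x_0$ ranging over $V\cap M$ only. *)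

theory Defs
  imports "HOL-Analysis.Analysis"
begin

unbundle cross3_syntax

subsection \<open>Smooth functions, gradients, regular values\<close>

text \<open>For open \<open>S\<close> the next predicate is membership in \<open>C^n\<close> over \<open>S\<close>: differentiability with all
  directional derivatives of class \<open>C^(n-1)\<close>. Values outside \<open>S\<close> are irrelevant.\<close>

fun Ck_on :: "nat \<Rightarrow> 'a::real_normed_vector set \<Rightarrow> ('a \<Rightarrow> 'b::real_normed_vector) \<Rightarrow> bool" where
  "Ck_on 0 S f \<longleftrightarrow> continuous_on S f"
| "Ck_on (Suc n) S f \<longleftrightarrow>
     (\<forall>x\<in>S. f differentiable (at x)) \<and>
     (\<forall>v. Ck_on n S (\<lambda>x. frechet_derivative f (at x) v))"

definition smooth_on :: "'a::real_normed_vector set \<Rightarrow> ('a \<Rightarrow> 'b::real_normed_vector) \<Rightarrow> bool" where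
  "smooth_on S f \<longleftrightarrow> (\<forall>n. Ck_on n S f)"

definition grad :: "('a::real_inner \<Rightarrow> real) \<Rightarrow> 'a \<Rightarrow> 'a" where
  "grad f u = (THE D. GDERIV f u :> D)"

lemma grad_eqI:
  assumes "GDERIV f u :> D"
  shows "grad f u = D"
  unfolding grad_def
proof (rule the_equality)
  show "GDERIV f u :> D" by (rule assms)
next
  fix D' assume "GDERIV f u :> D'"
  then have "(\<lambda>x. x \<bullet> D') = (\<lambda>x. x \<bullet> D)"
    using assms has_derivative_unique unfolding gderiv_def by blast
  then have "x \<bullet> D' = x \<bullet> D" for x
    by (rule fun_cong)
  then show "D' = D"
    using vector_eq_rdot[of D' D] by (simp add: inner_commute)
qed

text \<open>The inequality is needed because \<open>independent\<close> speaks about sets, so that equal gradients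
  would collapse to a singleton.\<close>

definition functionally_independent_on ::
  "'a::real_inner set \<Rightarrow> ('a \<Rightarrow> real) \<Rightarrow> ('a \<Rightarrow> real) \<Rightarrow> bool" where
  "functionally_independent_on V H C \<longleftrightarrow>
     (\<forall>u\<in>V. grad H u \<noteq> grad C u \<and> independent {grad H u, grad C u})"

definition regular_value ::
  "'a::real_normed_vector set \<Rightarrow> ('a \<Rightarrow> 'b::real_normed_vector) \<Rightarrow> 'b \<Rightarrow> bool" where
  "regular_value U f y \<longleftrightarrow>
     (\<forall>u\<in>U. f u = y \<longrightarrow> (\<exists>D. (f has_derivative D) (at u) \<and> surj D))"

subsection \<open>Solutions, periodic orbits, invariance\<close>

definition solution_on ::
  "('a::real_normed_vector \<Rightarrow> 'a) \<Rightarrow> 'a set \<Rightarrow> real set \<Rightarrow> (real \<Rightarrow> 'a) \<Rightarrow> bool" where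
  "solution_on X W I x \<longleftrightarrow>
     (\<forall>t\<in>I. x t \<in> W \<and> (x has_vector_derivative X (x t)) (at t within I))"

definition periodic_solution ::
  "('a::real_normed_vector \<Rightarrow> 'a) \<Rightarrow> 'a set \<Rightarrow> (real \<Rightarrow> 'a) \<Rightarrow> real \<Rightarrow> bool" where
  "periodic_solution X W \<gamma> T \<longleftrightarrow>
     T > 0 \<and> solution_on X W UNIV \<gamma> \<and> (\<forall>t. \<gamma> (t + T) = \<gamma> t) \<and> (\<exists>s t. \<gamma> s \<noteq> \<gamma> t)"

definition orbit_of :: "(real \<Rightarrow> 'a) \<Rightarrow> real \<Rightarrow> 'a set" where
  "orbit_of \<gamma> T = \<gamma> ` {0..T}"

definition dynamically_invariant ::
  "('a::real_normed_vector \<Rightarrow> 'a) \<Rightarrow> 'a set \<Rightarrow> 'a set \<Rightarrow> bool" where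
  "dynamically_invariant X V S \<longleftrightarrow>
     S \<subseteq> V \<and>
     (\<forall>I x. is_interval I \<and> solution_on X V I x \<and> (\<exists>t\<in>I. x t \<in> S) \<longrightarrow> (\<forall>t\<in>I. x t \<in> S))"

subsection \<open>Orbital stability\<close>

text \<open>In all notions below, \<open>W\<close> is the phase space: either the open set on which the system is
  considered, or a dynamically invariant subset of it, in which case the notion refers to the
  restricted system (initial points range over that subset only). A solution starting at \<open>x0\<close> is
  unique because the vector fields in question are smooth, so the existential quantifier over
  \<open>x\<close> merely names the solution \<open>x(t; x0)\<close> and makes explicit that it is defined for all
  \<open>t \<ge> 0\<close>; in particular, leaving the phase space in finite time counts against stability.\<close>

definition forward_solution ::
  "('a::real_normed_vector \<Rightarrow> 'a) \<Rightarrow> 'a set \<Rightarrow> 'a \<Rightarrow> (real \<Rightarrow> 'a) \<Rightarrow> bool" where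
  "forward_solution X W x0 x \<longleftrightarrow> x 0 = x0 \<and> solution_on X W {0..} x"

definition orbitally_stable ::
  "('a::real_normed_vector \<Rightarrow> 'a) \<Rightarrow> 'a set \<Rightarrow> 'a set \<Rightarrow> bool" where
  "orbitally_stable X W \<Gamma> \<longleftrightarrow>
     (\<forall>\<epsilon>>0. \<exists>\<delta>>0. \<forall>x0\<in>W. infdist x0 \<Gamma> < \<delta> \<longrightarrow>
        (\<exists>x. forward_solution X W x0 x \<and> (\<forall>t>0. infdist (x t) \<Gamma> < \<epsilon>)))"

definition orbitally_unstable ::
  "('a::real_normed_vector \<Rightarrow> 'a) \<Rightarrow> 'a set \<Rightarrow> 'a set \<Rightarrow> bool" where
  "orbitally_unstable X W \<Gamma> \<longleftrightarrow> \<not> orbitally_stable X W \<Gamma>"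

definition orbitally_asymptotically_stable ::
  "('a::real_normed_vector \<Rightarrow> 'a) \<Rightarrow> 'a set \<Rightarrow> 'a set \<Rightarrow> bool" where
  "orbitally_asymptotically_stable X W \<Gamma> \<longleftrightarrow>
     orbitally_stable X W \<Gamma> \<and>
     (\<exists>\<delta>>0. \<forall>x0\<in>W. infdist x0 \<Gamma> < \<delta> \<longrightarrow>
        (\<exists>x. forward_solution X W x0 x \<and> ((\<lambda>t. infdist (x t) \<Gamma>) \<longlongrightarrow> 0) at_top))"

definition orbitally_phase_asymptotically_stable ::
  "('a::real_normed_vector \<Rightarrow> 'a) \<Rightarrow> 'a set \<Rightarrow> (real \<Rightarrow> 'a) \<Rightarrow> real \<Rightarrow> bool" where
  "orbitally_phase_asymptotically_stable X W \<gamma> T \<longleftrightarrow>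
     orbitally_asymptotically_stable X W (orbit_of \<gamma> T) \<and>
     (\<exists>\<delta>>0. \<forall>x0\<in>W. infdist x0 (orbit_of \<gamma> T) < \<delta> \<longrightarrow>
        (\<exists>x \<theta>. forward_solution X W x0 x \<and>
           ((\<lambda>t. dist (x t) (\<gamma> (t + \<theta>))) \<longlongrightarrow> 0) at_top))"

subsection \<open>The vector fields\<close>

definition ham_field ::
  "(real^3 \<Rightarrow> real) \<Rightarrow> (real^3 \<Rightarrow> real) \<Rightarrow> (real^3 \<Rightarrow> real) \<Rightarrow> real^3 \<Rightarrow> real^3" where
  "ham_field \<nu> H C u = \<nu> u *\<^sub>R (grad H u \<times> grad C u)"

text \<open>Perturbation directions: \<open>C_part\<close> multiplies \<open>H - h\<close> and is orthogonal to the gradient of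
  \<open>C\<close>; \<open>H_part\<close> multiplies \<open>C - c\<close> and is orthogonal to the gradient of \<open>H\<close>.\<close>

definition C_part :: "(real^3 \<Rightarrow> real) \<Rightarrow> (real^3 \<Rightarrow> real) \<Rightarrow> real^3 \<Rightarrow> real^3" where
  "C_part H C u = grad C u \<times> (grad H u \<times> grad C u)"

definition H_part :: "(real^3 \<Rightarrow> real) \<Rightarrow> (real^3 \<Rightarrow> real) \<Rightarrow> real^3 \<Rightarrow> real^3" where
  "H_part H C u = grad H u \<times> (grad H u \<times> grad C u)"

end

theory Submission
  imports Defs
begin

text \<open>
  Write \<open>n = \<nabla>H \<times> \<nabla>C\<close>. Along the perturbed flow \<open>H - h\<close> and \<open>C - c\<close> obey the scalar linear equations
  \<open>(H - h)' = \<mp> \<alpha> |n|\<^sup>2 (H - h)\<close> and \<open>(C - c)' = \<mp> \<beta> |n|\<^sup>2 (C - c)\<close>, whose rates are bounded away from 0 on a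
  compact tube around \<open>\<Gamma>\<close>. If a rate is positive the corresponding quantity grows exponentially, which
  contradicts its boundedness on the tube. If the rates are negative, \<open>|H - h| + |C - c|\<close> decays
  exponentially and dominates the distance to \<open>\<Gamma>\<close>, because the two gradients span the plane normal to \<open>\<Gamma>\<close>.
  The phase comes without Floquet theory: by Gronwall, the points of \<open>\<Gamma>\<close> nearest to \<open>x(T), x(2T), \<dots>\<close>
  form a Cauchy sequence, and its limit fixes the phase.
\<close>

section \<open>Solutions of Lipschitz differential equations\<close>

text \<open>Stability as defined demands a solution for all \<open>t \<ge> 0\<close>, while the
  field is controlled only near \<Gamma>. This obstacle shapes the proof: the field is cut off
  outside a tube to a bounded, globally Lipschitz one, that one is solved on the whole half-line,
  and a first-exit argument shows that the solution never reaches the region where the field was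
  altered. The distance estimate rests on \<open>\<nu>\<close> being nonzero on \<Gamma>: minimality
  makes the displacement from the nearest orbit point orthogonal to the velocity
  \<open>\<nu> n\<close>, which says something about \<open>n\<close> only if \<open>\<nu>\<close>
  does not vanish. Nonconstancy of \<open>\<gamma>\<close> and uniqueness of solutions provide this.
  All sign variants belong to one family of fields with coefficient functions \<open>a\<close> and
  \<open>b\<close>, so one stability and one instability criterion suffice.\<close>

lemma linear_growth_bound:
  fixes f f' :: "real \<Rightarrow> real"
  assumes "s \<le> t"
    and f': "\<And>u. u \<in> {s..t} \<Longrightarrow> (f has_real_derivative f' u) (at u within {s..t})"
    and le: "\<And>u. u \<in> {s..t} \<Longrightarrow> f' u \<le> k * f u"
  shows "f t \<le> exp (k * (t - s)) * f s"
proof -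
  \<comment> \<open>The integrating factor makes \<open>g\<close> nonincreasing. \<open>f\<close>
    and \<open>k\<close> may have any sign, which later allows \<open>f = - y^2\<close> and so lower
    bounds.\<close>
  define g where "g u = exp (- k * u) * f u" for u
  have g': "(g has_derivative (*) (exp (- k * u) * (f' u - k * f u))) (at u within {s..t})"
    if "u \<in> {s..t}" for u
    unfolding g_def has_field_derivative_def [symmetric]
    by (rule derivative_eq_intros f' that refl | simp add: algebra_simps)+
  obtain u where "u \<in> {s..t}" and "g t - g s = exp (- k * u) * (f' u - k * f u) * (t - s)"
    using mvt_very_simple [OF \<open>s \<le> t\<close> g'] by auto
  moreover have "exp (- k * u) * (f' u - k * f u) * (t - s) \<le> 0"
    using le [OF \<open>u \<in> {s..t}\<close>] \<open>s \<le> t\<close>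
    by (auto simp: mult_le_0_iff)
  ultimately have "exp (- k * t) * f t \<le> exp (- k * s) * f s"
    by (simp add: g_def)
  then have "exp (k * t) * (exp (- k * t) * f t) \<le> exp (k * t) * (exp (- k * s) * f s)"
    by (rule mult_left_mono) simp
  then show ?thesis
    by (simp add: mult.assoc [symmetric] exp_add [symmetric] right_diff_distrib)
qed

lemma solution_on_mono:
  "solution_on X W I x \<Longrightarrow> W \<subseteq> W' \<Longrightarrow> J \<subseteq> I \<Longrightarrow> solution_on X W' J x"
  unfolding solution_on_def by (meson has_vector_derivative_within_subset subset_iff)

text \<open>Field and phase space are exchanged together: agreement of the fields along the
  trajectory is enough, which is how the cut-off and the original system are interchanged.\<close>

lemma solution_on_cong:
  assumes "solution_on X W I x" and "\<And>t. t \<in> I \<Longrightarrow> x t \<in> W' \<and> X (x t) = Y (x t)"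
  shows "solution_on Y W' I x"
  using assms unfolding solution_on_def by auto

text \<open>Gronwall's inequality for the squared distance, which stays differentiable where the two
  solutions meet; Cauchy-Schwarz bounds its derivative by \<open>2 * L\<close> times itself. Equal
  initial values give uniqueness.\<close>

lemma solution_dist_le:
  fixes X :: "'a::real_inner \<Rightarrow> 'a"
  assumes X: "L-lipschitz_on K X" and "s \<le> t"
    and x: "solution_on X K {s..t} x" and y: "solution_on X K {s..t} y"
  shows "norm (x t - y t) \<le> exp (L * (t - s)) * norm (x s - y s)"
proof -
  let ?z = "\<lambda>u. x u - y u"
  have z: "(?z has_vector_derivative (X (x u) - X (y u))) (at u within {s..t})"
    if "u \<in> {s..t}" for u
    using x y that unfolding solution_on_def by (auto intro!: has_vector_derivative_diff)
  have "((\<lambda>u. ?z u \<bullet> ?z u) has_real_derivative 2 * (?z u \<bullet> (X (x u) - X (y u)))) (at u within {s..t})"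
    if "u \<in> {s..t}" for u
    using has_derivative_inner [OF z [OF that, unfolded has_vector_derivative_def]
        z [OF that, unfolded has_vector_derivative_def]]
    unfolding has_field_derivative_def
    by (rule has_derivative_eq_rhs) (auto simp: inner_commute algebra_simps)
  moreover have "2 * (?z u \<bullet> (X (x u) - X (y u))) \<le> 2 * L * (?z u \<bullet> ?z u)"
    if "u \<in> {s..t}" for u
  proof -
    have "norm (X (x u) - X (y u)) \<le> L * norm (?z u)"
      using lipschitz_on_normD [OF X] x y that unfolding solution_on_def by auto
    then have "norm (?z u) * norm (X (x u) - X (y u)) \<le> norm (?z u) * (L * norm (?z u))"
      by (rule mult_left_mono) simp
    then show ?thesis
      using norm_cauchy_schwarz [of "?z u" "X (x u) - X (y u)"]
      by (simp add: dot_square_norm power2_eq_square algebra_simps)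
  qed
  ultimately have "?z t \<bullet> ?z t \<le> exp (2 * L * (t - s)) * (?z s \<bullet> ?z s)"
    by (intro linear_growth_bound [OF \<open>s \<le> t\<close>, of "\<lambda>u. ?z u \<bullet> ?z u"]) auto
  also have "\<dots> = (exp (L * (t - s)) * norm (?z s))\<^sup>2"
    by (simp add: dot_square_norm power_mult_distrib exp_double mult.assoc)
  finally show ?thesis
    by (simp add: dot_square_norm power2_le_iff_abs_le)
qed

lemma integral_has_vector_derivative_atLeast:
  fixes g :: "real \<Rightarrow> 'a::banach"
  assumes "continuous_on UNIV g" and "0 \<le> t"
  shows "((\<lambda>u. integral {0..u} g) has_vector_derivative g t) (at t within {0..})"
proof -
  \<comment> \<open>The right end \<open>t + 1\<close> lies beyond \<open>t\<close>, so that near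
    \<open>t\<close> the interval looks like the half-line.\<close>
  have "((\<lambda>u. integral {0..u} g) has_vector_derivative g t) (at t within {0..t + 1})"
    using assms by (intro integral_has_vector_derivative) (auto intro: continuous_on_subset)
  moreover have "at t within {0..t + 1} = at t within {0..}"
    by (rule at_within_nhd [where S = "{..<t + 1}"]) (use assms in auto)
  ultimately show ?thesis
    by simp
qed

text \<open>With the unknown \<open>y t = exp (- k * t) (x t - x0)\<close>, the Picard operator contracts the bounded continuous
  functions on the whole half-line, so no continuation argument is needed.\<close>

lemma global_solution:
  fixes X :: "'a::euclidean_space \<Rightarrow> 'a"
  assumes lip: "L-lipschitz_on UNIV X" and bound: "\<And>u. norm (X u) \<le> B"
  shows "\<exists>x. forward_solution X UNIV x0 x"
proof -
  \<comment> \<open>Under the weight \<open>exp (- k * t)\<close> the contraction ratio is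
    \<open>L / k\<close>, at most 1/2 as soon as \<open>k \<ge> 2 * L\<close>; the summand 1 keeps
    \<open>k\<close> positive when \<open>L = 0\<close>.\<close>
  define k where "k = 2 * L + 1"
  have "L \<ge> 0"
    using lip by (rule lipschitz_on_nonneg)
  then have "k > 0"
    by (simp add: k_def)
  have "B \<ge> 0"
    using bound [of 0] norm_ge_zero order_trans by blast
  have contX: "continuous_on UNIV X"
    using lip lipschitz_on_continuous_on by blast
  define f where "f y s = X (x0 + exp (k * s) *\<^sub>R apply_bcontfun y s)" for y s
  define G where "G y t = integral {0..t} (f y)" for y t
  \<comment> \<open>The bounded continuous functions live on the whole line; \<open>max 0 t\<close>
    extends the operator to negative times by its value at 0, which is 0.\<close>
  define \<Phi> where "\<Phi> y t = exp (- k * max 0 t) *\<^sub>R G y (max 0 t)" for y t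
  have contf: "continuous_on UNIV (f y)" for y
    unfolding f_def
    by (rule continuous_on_compose2 [OF contX]) (auto intro!: continuous_intros)
  have intf: "f y integrable_on {0..t}" for y t
    by (rule integrable_continuous_real) (rule continuous_on_subset [OF contf], simp)
  have G': "(G y has_vector_derivative f y t) (at t within {0..})" if "t \<ge> 0" for y t
    unfolding G_def using contf that by (rule integral_has_vector_derivative_atLeast)
  then have contG: "continuous_on {0..} (G y)" for y
    by (meson atLeast_iff continuous_on_eq_continuous_within has_vector_derivative_continuous)
  have "\<Phi> y \<in> bcontfun" for y
  proof (rule bcontfun_normI [where b = "B / k"])
    show "continuous_on UNIV (\<Phi> y)"
      unfolding \<Phi>_def
      by (intro continuous_intros continuous_on_compose2 [OF contG]) auto
    \<comment> \<open>The integral grows at most like \<open>B * t\<close>, and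
      \<open>t * exp (- k * t) \<le> 1 / k\<close>.\<close>
    show "norm (\<Phi> y t) \<le> B / k" for t
    proof -
      let ?t = "max 0 t"
      have "norm (G y ?t) \<le> B * (?t - 0)"
        unfolding G_def
        by (intro integral_bound continuous_on_subset [OF contf]) (auto simp: f_def bound)
      then have "norm (\<Phi> y t) \<le> exp (- (k * ?t)) * (B * ?t)"
        by (simp add: \<Phi>_def)
      also have "\<dots> \<le> B / k"
      proof -
        have "k * ?t \<le> exp (k * ?t)"
          using exp_ge_add_one_self [of "k * ?t"] by linarith
        then have "B * (k * ?t) \<le> B * exp (k * ?t)"
          using \<open>B \<ge> 0\<close> by (rule mult_left_mono)
        then show ?thesis
          using \<open>k > 0\<close> by (simp add: exp_minus field_simps)
      qed
      finally show ?thesis .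
    qed
  qed
  then have app: "apply_bcontfun (Bcontfun (\<Phi> y)) = \<Phi> y" for y
    by (rule Bcontfun_inverse)
  have "dist (Bcontfun (\<Phi> y)) (Bcontfun (\<Phi> z)) \<le> 1/2 * dist y z" for y z
  proof (rule dist_bound)
    fix t :: real
    let ?t = "max 0 t" and ?d = "dist y z"
    \<comment> \<open>Integrating the Lipschitz bound gives
      \<open>L * ?d / k * (exp (k * ?t) - 1)\<close>; the weight cancels the exponential and leaves
      at most \<open>L * ?d / k\<close>.\<close>
    have expint: "((\<lambda>s. L * ?d * exp (k * s)) has_integral
        L * ?d / k * exp (k * ?t) - L * ?d / k * exp (k * 0)) {0..?t}"
      by (rule fundamental_theorem_of_calculus)
        (auto intro!: derivative_eq_intros simp: has_real_derivative_iff_has_vector_derivative [symmetric]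
          \<open>k > 0\<close>[THEN less_imp_neq, symmetric])
    have "norm (G y ?t - G z ?t) = norm (integral {0..?t} (\<lambda>s. f y s - f z s))"
      by (simp add: G_def integral_diff intf)
    also have "\<dots> \<le> integral {0..?t} (\<lambda>s. L * ?d * exp (k * s))"
    proof (rule integral_norm_bound_integral)
      show "(\<lambda>s. f y s - f z s) integrable_on {0..?t}"
        by (intro integrable_diff intf)
      show "(\<lambda>s. L * ?d * exp (k * s)) integrable_on {0..?t}"
        using expint by blast
      fix s
      have "norm (f y s - f z s)
          \<le> L * norm (exp (k * s) *\<^sub>R (apply_bcontfun y s - apply_bcontfun z s))"
        using lipschitz_on_normD [OF lip, of "x0 + exp (k * s) *\<^sub>R apply_bcontfun y s"
            "x0 + exp (k * s) *\<^sub>R apply_bcontfun z s"]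
        by (simp add: f_def algebra_simps)
      also have "\<dots> \<le> L * (exp (k * s) * ?d)"
        using dist_bounded [of y s z] \<open>L \<ge> 0\<close>
        by (intro mult_left_mono) (auto simp: dist_norm)
      finally show "norm (f y s - f z s) \<le> L * ?d * exp (k * s)"
        by (simp add: algebra_simps)
    qed
    also have "\<dots> \<le> L * ?d / k * exp (k * ?t)"
      using integral_unique [OF expint] \<open>L \<ge> 0\<close> \<open>k > 0\<close> by simp
    finally have "exp (- (k * ?t)) * norm (G y ?t - G z ?t) \<le> L * ?d / k"
      by (simp add: exp_minus field_simps)
    moreover have "dist (\<Phi> y t) (\<Phi> z t) = exp (- (k * ?t)) * norm (G y ?t - G z ?t)"
      by (simp add: \<Phi>_def dist_norm flip: scaleR_diff_right)
    moreover have "L * ?d / k \<le> 1/2 * ?d"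
      using \<open>k > 0\<close> \<open>L \<ge> 0\<close> mult_nonneg_nonneg [of L ?d] by (simp add: k_def field_simps)
    ultimately have "dist (\<Phi> y t) (\<Phi> z t) \<le> 1/2 * ?d"
      by linarith
    then show "dist (apply_bcontfun (Bcontfun (\<Phi> y)) t) (apply_bcontfun (Bcontfun (\<Phi> z)) t)
        \<le> 1/2 * ?d"
      by (simp only: app)
  qed
  then obtain y where "Bcontfun (\<Phi> y) = y"
    using banach_fix_type [of "1/2" "\<lambda>y. Bcontfun (\<Phi> y)"] by auto
  then have y: "apply_bcontfun y = \<Phi> y"
    using app by metis
  \<comment> \<open>For \<open>t \<ge> 0\<close> the weights cancel, so the fixed point equation
    becomes the integral equation for \<open>x0 + G y t\<close>.\<close>
  have x: "x0 + exp (k * t) *\<^sub>R apply_bcontfun y t = x0 + G y t" if "t \<ge> 0" for t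
    using that by (simp add: y \<Phi>_def exp_minus)
  have "((\<lambda>t. x0 + G y t) has_vector_derivative X (x0 + G y t)) (at t within {0..})"
    if "t \<ge> 0" for t
    using G' [OF that, of y] x [OF that] by (auto simp: f_def intro!: derivative_eq_intros)
  then have "forward_solution X UNIV x0 (\<lambda>t. x0 + G y t)"
    unfolding forward_solution_def solution_on_def by (auto simp: G_def)
  then show ?thesis
    by blast
qed

text \<open>Multiplication by a piecewise linear function of the distance to \<Gamma>, equal to 1 up
  to \<open>r\<close> and to 0 from \<open>\<rho>\<close> on. Its slope
  \<open>1 / (\<rho> - r)\<close> is why the radii must differ; outside the larger tube nothing is
  known about \<open>X\<close>, but the factor vanishes there.\<close>

lemma lipschitz_cutoff:
  fixes X :: "'a::euclidean_space \<Rightarrow> 'b::real_normed_vector"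
  assumes "compact \<Gamma>" "\<Gamma> \<noteq> {}" "0 < r" "r < \<rho>"
    and X: "L-lipschitz_on {u. infdist u \<Gamma> \<le> \<rho>} X"
  obtains Y M B where "M-lipschitz_on UNIV Y" "\<And>u. norm (Y u) \<le> B"
    "\<And>u. infdist u \<Gamma> \<le> r \<Longrightarrow> Y u = X u"
proof -
  let ?K = "{u. infdist u \<Gamma> \<le> \<rho>}"
  have "compact ?K"
    using assms by (intro compact_infdist_le) auto
  then have "bounded (X ` ?K)"
    using X by (intro compact_imp_bounded compact_continuous_image lipschitz_on_continuous_on)
  then obtain B where "B > 0" and B: "\<And>u. u \<in> ?K \<Longrightarrow> norm (X u) \<le> B"
    unfolding bounded_pos by auto
  have "L \<ge> 0"
    using X by (rule lipschitz_on_nonneg)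
  define \<psi> where "\<psi> u = max 0 (min 1 ((\<rho> - infdist u \<Gamma>) / (\<rho> - r)))" for u
  define Y where "Y u = \<psi> u *\<^sub>R X u" for u
  have \<psi>: "0 \<le> \<psi> u" "\<psi> u \<le> 1" for u
    by (auto simp: \<psi>_def)
  have \<psi>0: "\<psi> u = 0" if "u \<notin> ?K" for u
    using that \<open>r < \<rho>\<close> by (auto simp: \<psi>_def zero_le_divide_iff max_def min_def)
  have \<psi>lip: "\<bar>\<psi> u - \<psi> v\<bar> \<le> dist u v / (\<rho> - r)" for u v
  proof -
    have "\<bar>\<psi> u - \<psi> v\<bar> \<le> \<bar>(\<rho> - infdist u \<Gamma>) / (\<rho> - r) - (\<rho> - infdist v \<Gamma>) / (\<rho> - r)\<bar>"
      by (auto simp: \<psi>_def max_def min_def)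
    also have "\<dots> = \<bar>infdist u \<Gamma> - infdist v \<Gamma>\<bar> / (\<rho> - r)"
      using \<open>r < \<rho>\<close> by (simp add: diff_divide_distrib [symmetric] abs_minus_commute)
    also have "\<dots> \<le> dist u v / (\<rho> - r)"
      using \<open>r < \<rho>\<close> infdist_triangle_abs by (intro divide_right_mono) auto
    finally show ?thesis .
  qed
  let ?M = "L + B / (\<rho> - r)"
  \<comment> \<open>By symmetry one of the two points may be taken in \<open>?K\<close>; if both lie
    outside, \<open>Y\<close> vanishes at both.\<close>
  have le: "dist (Y u) (Y v) \<le> ?M * dist u v" if "u \<in> ?K" for u v
  proof -
    have *: "B * \<bar>\<psi> u - \<psi> v\<bar> \<le> B / (\<rho> - r) * dist u v"
      using mult_left_mono [OF \<psi>lip, of B u v] \<open>B > 0\<close> by simp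
    show ?thesis
    proof (cases "v \<in> ?K")
      case True
      have "Y u - Y v = \<psi> v *\<^sub>R (X u - X v) + (\<psi> u - \<psi> v) *\<^sub>R X u"
        by (simp add: Y_def algebra_simps)
      then have "norm (Y u - Y v) \<le> \<psi> v * norm (X u - X v) + \<bar>\<psi> u - \<psi> v\<bar> * norm (X u)"
        using norm_triangle_ineq [of "\<psi> v *\<^sub>R (X u - X v)" "(\<psi> u - \<psi> v) *\<^sub>R X u"] \<psi>(1) [of v]
        by simp
      also have "\<dots> \<le> 1 * (L * norm (u - v)) + \<bar>\<psi> u - \<psi> v\<bar> * B"
        using \<psi> [of v] lipschitz_on_normD [OF X \<open>u \<in> ?K\<close> True] B [OF \<open>u \<in> ?K\<close>] \<open>L \<ge> 0\<close>
        by (intro add_mono mult_mono) auto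
      finally show ?thesis
        using * by (simp add: dist_norm algebra_simps)
    next
      case False
      then have "norm (Y u - Y v) = \<bar>\<psi> u - \<psi> v\<bar> * norm (X u)"
        by (simp add: Y_def \<psi>0)
      also have "\<dots> \<le> \<bar>\<psi> u - \<psi> v\<bar> * B"
        using B [OF \<open>u \<in> ?K\<close>] by (intro mult_left_mono) auto
      finally have "norm (Y u - Y v) \<le> B / (\<rho> - r) * dist u v"
        using * by (simp add: mult.commute)
      moreover have "0 \<le> L * dist u v"
        using \<open>L \<ge> 0\<close> by simp
      ultimately show ?thesis
        unfolding dist_norm [of "Y u"] distrib_right by linarith
    qed
  qed
  have "?M-lipschitz_on UNIV Y"
  proof (rule lipschitz_onI)
    show "?M \<ge> 0"
      using \<open>L \<ge> 0\<close> \<open>B > 0\<close> \<open>r < \<rho>\<close> by simp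
    show "dist (Y u) (Y v) \<le> ?M * dist u v" for u v
    proof (cases "u \<in> ?K \<or> v \<in> ?K")
      case True
      then show ?thesis
        using le [of u v] le [of v u] by (metis dist_commute)
    next
      case False
      then show ?thesis
        using \<psi>0 [of u] \<psi>0 [of v] \<open>?M \<ge> 0\<close> by (simp add: Y_def)
    qed
  qed
  moreover have "norm (Y u) \<le> B" for u
  proof (cases "u \<in> ?K")
    case True
    then show ?thesis
      using mult_mono [OF \<psi>(2) B [OF True]] \<psi>(1) [of u] by (simp add: Y_def)
  next
    case False
    then show ?thesis
      using \<psi>0 [of u] \<open>B > 0\<close> by (simp add: Y_def)
  qed
  moreover have "Y u = X u" if "infdist u \<Gamma> \<le> r" for u
  proof -
    have "1 \<le> (\<rho> - infdist u \<Gamma>) / (\<rho> - r)"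
      using that \<open>r < \<rho>\<close> by simp
    then show ?thesis
      by (simp add: Y_def \<psi>_def)
  qed
  ultimately show thesis
    by (rule that)
qed

text \<open>On a compact set Lipschitz factors are bounded, so the product rule for differences
  applies. The bilinear form covers multiplication, scaling and the cross product at once.\<close>

lemma (in bounded_bilinear) lipschitz_on_prod:
  fixes f :: "'d::metric_space \<Rightarrow> 'a" and g :: "'d \<Rightarrow> 'b"
  assumes "compact K" and "\<exists>L. L-lipschitz_on K f" and "\<exists>L. L-lipschitz_on K g"
  shows "\<exists>L. L-lipschitz_on K (\<lambda>u. prod (f u) (g u))"
proof -
  obtain L M where L: "L-lipschitz_on K f" and M: "M-lipschitz_on K g"
    using assms by blast
  have bdd: "bounded (f ` K)" "bounded (g ` K)"
    using L M \<open>compact K\<close>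
    by (auto intro!: compact_imp_bounded compact_continuous_image lipschitz_on_continuous_on)
  obtain A where "A > 0" and A: "\<And>u. u \<in> K \<Longrightarrow> norm (f u) \<le> A"
    using bdd(1) unfolding bounded_pos by auto
  obtain B where "B > 0" and B: "\<And>u. u \<in> K \<Longrightarrow> norm (g u) \<le> B"
    using bdd(2) unfolding bounded_pos by auto
  obtain N where "N > 0" and N: "\<And>x y. norm (prod x y) \<le> norm x * norm y * N"
    using pos_bounded by blast
  have nn: "L \<ge> 0" "M \<ge> 0"
    using L M lipschitz_on_nonneg by auto
  have "((A * M + L * B) * N)-lipschitz_on K (\<lambda>u. prod (f u) (g u))"
  proof (rule lipschitz_onI)
    show "0 \<le> (A * M + L * B) * N"
      using nn \<open>A > 0\<close> \<open>B > 0\<close> \<open>N > 0\<close> by simp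
    fix u v assume "u \<in> K" "v \<in> K"
    have "prod (f u) (g u) - prod (f v) (g v) = prod (f u) (g u - g v) + prod (f u - f v) (g v)"
      by (simp add: diff_left diff_right)
    then have "norm (prod (f u) (g u) - prod (f v) (g v)) \<le> norm (prod (f u) (g u - g v)) + norm (prod (f u - f v) (g v))"
      by (simp add: norm_triangle_ineq)
    also have "\<dots> \<le> norm (f u) * norm (g u - g v) * N + norm (f u - f v) * norm (g v) * N"
      by (intro add_mono N)
    also have "\<dots> \<le> A * (M * dist u v) * N + L * dist u v * B * N"
      using A B \<open>u \<in> K\<close> \<open>v \<in> K\<close> nn \<open>A > 0\<close> \<open>B > 0\<close> \<open>N > 0\<close>
        lipschitz_onD [OF L, of u v] lipschitz_onD [OF M, of u v]
      by (intro add_mono mult_mono) (auto simp: dist_norm)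
    finally show "dist (prod (f u) (g u)) (prod (f v) (g v)) \<le> (A * M + L * B) * N * dist u v"
      by (simp add: dist_norm algebra_simps)
  qed
  then show ?thesis
    by blast
qed

text \<open>\<open>K\<close> may fail to be convex, so the mean value inequality is used on balls
  only; compactness then turns the local constants into a single one.\<close>

lemma Ck_on_Suc_0_imp_lipschitz:
  fixes f :: "'a::euclidean_space \<Rightarrow> 'b::real_normed_vector"
  assumes "open S" and f: "Ck_on (Suc 0) S f" and "compact K" "K \<subseteq> S"
  shows "\<exists>L. L-lipschitz_on K f"
proof -
  let ?D = "\<lambda>u. frechet_derivative f (at u)"
  have f': "(f has_derivative ?D u) (at u)" if "u \<in> S" for u
    using f that frechet_derivative_works by auto
  \<comment> \<open>\<open>local_lipschitz\<close> concerns time-dependent maps; the single time 0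
    is a dummy.\<close>
  have "local_lipschitz {0::real} S (\<lambda>_. f)"
  proof (rule local_lipschitzI)
    fix x assume "x \<in> S"
    then obtain r where "r > 0" and r: "cball x r \<subseteq> S"
      using \<open>open S\<close> open_contains_cball by blast
    have "bounded ((\<lambda>u. ?D u i) ` cball x r)" for i
      using f r by (intro compact_imp_bounded compact_continuous_image) (auto intro: continuous_on_subset)
    then have "\<exists>b. \<forall>u\<in>cball x r. norm (?D u i) \<le> b" for i
      unfolding bounded_iff by auto
    then obtain b where b: "\<And>i u. u \<in> cball x r \<Longrightarrow> norm (?D u i) \<le> b i"
      by metis
    \<comment> \<open>\<open>Ck_on\<close> controls each directional derivative separately; the
      bounds along the basis vectors add up to a bound for the operator norm.\<close>
    have "(\<Sum>i\<in>Basis. b i)-lipschitz_on (cball x r) f"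
    proof (rule lipschitz_onI)
      show "0 \<le> sum b Basis"
        using b [of x] \<open>r > 0\<close> order_trans [OF norm_ge_zero]
        by (intro sum_nonneg) (auto simp del: norm_ge_zero)
      have "onorm (?D u) \<le> sum b Basis" if "u \<in> cball x r" for u
      proof (rule onorm_le)
        fix v
        interpret bounded_linear "?D u"
          using f' r that has_derivative_bounded_linear by blast
        have "?D u v = (\<Sum>i\<in>Basis. (v \<bullet> i) *\<^sub>R ?D u i)"
          by (subst euclidean_representation [symmetric, of v]) (simp only: sum scaleR)
        also have "norm \<dots> \<le> (\<Sum>i\<in>Basis. b i * norm v)"
          using b [OF that]
          by (intro sum_norm_le) (auto simp: mult.commute Basis_le_norm intro!: mult_mono)
        finally show "norm (?D u v) \<le> sum b Basis * norm v"
          by (simp add: sum_distrib_right)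
      qed
      then show "dist (f u) (f v) \<le> sum b Basis * dist u v"
        if "u \<in> cball x r" "v \<in> cball x r" for u v
        unfolding dist_norm using r that
        by (intro differentiable_bound [where S = "cball x r" and f' = ?D])
          (auto intro!: has_derivative_at_withinI f')
    qed
    then show "\<exists>u>0. \<exists>L. \<forall>s\<in>cball t u \<inter> {0}. L-lipschitz_on (cball x u \<inter> S) f" for t :: real
      using \<open>r > 0\<close> lipschitz_on_subset by blast
  qed
  then have "local_lipschitz {0::real} K (\<lambda>_. f)"
    by (rule local_lipschitz_subset) (use \<open>K \<subseteq> S\<close> in auto)
  then show ?thesis
    using local_lipschitz_compact_implies_lipschitz [where f = "\<lambda>_. f" and T = "{0::real}" and X = K] \<open>compact K\<close>
    by (metis continuous_on_sing finite.emptyI finite.insertI finite_imp_compact insertI1)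
qed

section \<open>Exponential attraction to a periodic orbit\<close>

text \<open>Only what concerns the curve itself is fixed, with phase space \<open>UNIV\<close>, so
  that the Hamiltonian field and each perturbed field are instances with the same
  \<open>\<gamma>\<close>.\<close>

locale periodic_orbit =
  fixes X :: "'a::euclidean_space \<Rightarrow> 'a" and \<gamma> :: "real \<Rightarrow> 'a" and T :: real
  assumes T_pos: "T > 0"
    and sol: "solution_on X UNIV UNIV \<gamma>"
    and per: "\<gamma> (t + T) = \<gamma> t"
begin

lemma per_nat: "\<gamma> (t + real n * T) = \<gamma> t"
proof (induction n)
  case (Suc n)
  have "\<gamma> (t + real (Suc n) * T) = \<gamma> (t + real n * T + T)"
    by (simp add: algebra_simps)
  then show ?case
    using Suc per by simp
qed simp

lemma deriv: "(\<gamma> has_vector_derivative X (\<gamma> t)) (at t)"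
  using sol unfolding solution_on_def by simp

lemma mem_orbit: "\<gamma> t \<in> orbit_of \<gamma> T"
proof -
  let ?k = "\<lfloor>t / T\<rfloor>"
  have "?k * T \<le> t" and "t < ?k * T + T"
    using floor_divide_lower [OF T_pos, of t] floor_divide_upper [OF T_pos, of t]
    by (auto simp: algebra_simps)
  then have "t - ?k * T \<in> {0..T}"
    by auto
  moreover have "\<gamma> t = \<gamma> (t - ?k * T)"
  \<comment> \<open>\<open>per_nat\<close> shifts by nonnegative multiples only; for negative
    \<open>?k\<close> it is applied at \<open>t\<close> itself.\<close>
  proof (cases "?k \<ge> 0")
    case True
    then show ?thesis
      using per_nat [of "t - ?k * T" "nat ?k"] by simp
  next
    case False
    then show ?thesis
      using per_nat [of t "nat (- ?k)"] by simp
  qed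
  ultimately show ?thesis
    unfolding orbit_of_def by blast
qed

lemma orbit_range: "orbit_of \<gamma> T = range \<gamma>"
  using mem_orbit by (auto simp: orbit_of_def)

lemma compact_orbit: "compact (orbit_of \<gamma> T)"
  unfolding orbit_of_def using deriv
  by (intro compact_continuous_image continuous_at_imp_continuous_on)
    (auto intro: has_vector_derivative_continuous)

lemma orbit_nonempty: "orbit_of \<gamma> T \<noteq> {}"
  using mem_orbit by blast

lemma nearest_point: obtains s where "infdist u (orbit_of \<gamma> T) = dist u (\<gamma> s)"
  using infdist_attains_inf [OF compact_imp_closed [OF compact_orbit] orbit_nonempty, of u]
  unfolding orbit_range by blast

lemma shift: "solution_on X (orbit_of \<gamma> T) I (\<lambda>t. \<gamma> (t + \<theta>))"
proof -
  have "((\<lambda>t. \<gamma> (t + \<theta>)) has_vector_derivative 1 *\<^sub>R X (\<gamma> (t + \<theta>))) (at t)" for t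
  proof -
    have "((\<lambda>t. t + \<theta>) has_vector_derivative 1) (at t)"
      by (auto intro!: derivative_eq_intros)
    from vector_diff_chain_at [OF this deriv] show ?thesis
      by (simp add: o_def)
  qed
  then show ?thesis
    unfolding solution_on_def using mem_orbit by (auto intro: has_vector_derivative_at_within)
qed

text \<open>Followed over one period, the orbit point nearest to \<open>x (n T)\<close> returns to
  itself, while by Gronwall it stays near \<open>x\<close>. Hence it and the next nearest point both
  lie within a multiple of \<open>q ^ n\<close> of \<open>x ((n + 1) T)\<close>.\<close>

lemma asymptotic_phase:
  assumes "\<rho> \<ge> 0" and lip: "L-lipschitz_on {u. infdist u (orbit_of \<gamma> T) \<le> \<rho>} X"
    and x: "solution_on X {u. infdist u (orbit_of \<gamma> T) \<le> \<rho>} {0..} x"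
    and "\<mu> > 0" and dec: "\<And>t. t \<ge> 0 \<Longrightarrow> infdist (x t) (orbit_of \<gamma> T) \<le> A * exp (- \<mu> * t)"
  shows "\<exists>\<theta>. ((\<lambda>t. dist (x t) (\<gamma> (t + \<theta>))) \<longlongrightarrow> 0) at_top"
proof -
  let ?\<Gamma> = "orbit_of \<gamma> T" and ?K = "{u. infdist u (orbit_of \<gamma> T) \<le> \<rho>}"
  define E where "E = exp (L * T)"
  define q where "q = exp (- \<mu> * T)"
  have "L \<ge> 0"
    using lip by (rule lipschitz_on_nonneg)
  have q: "0 < q" "q < 1"
    using \<open>\<mu> > 0\<close> T_pos by (auto simp: q_def)
  have "?\<Gamma> \<subseteq> ?K"
    using \<open>\<rho> \<ge> 0\<close> by auto
  \<comment> \<open>Comparison over at most one period keeps the Gronwall factor below the constant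
    \<open>E\<close>.\<close>
  have close: "dist (x b) (\<gamma> (b + \<theta>)) \<le> E * dist (x a) (\<gamma> (a + \<theta>))"
    if "0 \<le> a" "a \<le> b" "b \<le> a + T" for a b \<theta>
  proof -
    have "norm (x b - \<gamma> (b + \<theta>)) \<le> exp (L * (b - a)) * norm (x a - \<gamma> (a + \<theta>))"
    proof (rule solution_dist_le [where y = "\<lambda>t. \<gamma> (t + \<theta>)", OF lip \<open>a \<le> b\<close>])
      show "solution_on X ?K {a..b} x"
        by (rule solution_on_mono [OF x]) (use that in auto)
      show "solution_on X ?K {a..b} (\<lambda>t. \<gamma> (t + \<theta>))"
        by (rule solution_on_mono [OF shift \<open>?\<Gamma> \<subseteq> ?K\<close>]) auto
    qed
    also have "\<dots> \<le> E * norm (x a - \<gamma> (a + \<theta>))"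
      unfolding E_def using that \<open>L \<ge> 0\<close> by (intro mult_right_mono) (auto intro: mult_left_mono)
    finally show ?thesis
      by (simp add: dist_norm)
  qed
  have qn: "exp (- \<mu> * (real n * T)) = q ^ n" for n
    by (simp add: q_def exp_of_nat_mult [symmetric] mult.commute mult.left_commute)
  have "\<exists>s. infdist (x (real n * T)) ?\<Gamma> = dist (x (real n * T)) (\<gamma> s)" for n
    using nearest_point by blast
  then obtain s where s: "\<And>n. infdist (x (real n * T)) ?\<Gamma> = dist (x (real n * T)) (\<gamma> (s n))"
    by metis
  let ?g = "\<lambda>n. \<gamma> (s n)"
  have xg: "dist (x (real n * T)) (?g n) \<le> A * q ^ n" for n
    using dec [of "real n * T"] T_pos s [of n] qn [of n] by simp
  have step: "norm (?g (Suc n) - ?g n) \<le> (A * q + E * A) * q ^ n" for n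
  proof -
    \<comment> \<open>This phase puts the comparison solution at \<open>?g n\<close> at time
      \<open>n T\<close>.\<close>
    let ?\<theta> = "s n - real n * T"
    have "dist (x (real (Suc n) * T)) (\<gamma> (real (Suc n) * T + ?\<theta>)) \<le> E * dist (x (real n * T)) (\<gamma> (real n * T + ?\<theta>))"
      using T_pos by (intro close) (auto simp: algebra_simps)
    also have "\<gamma> (real (Suc n) * T + ?\<theta>) = ?g n"
      using per [of "s n"] by (simp add: algebra_simps)
    also have "E * dist (x (real n * T)) (\<gamma> (real n * T + ?\<theta>)) \<le> E * (A * q ^ n)"
      using xg by (intro mult_left_mono) (auto simp: E_def)
    finally have "dist (x (real (Suc n) * T)) (?g n) \<le> E * (A * q ^ n)" .
    then show ?thesis
      using xg [of "Suc n"] dist_triangle3 [of "?g (Suc n)" "?g n" "x (real (Suc n) * T)"]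
      by (simp add: dist_norm algebra_simps)
  qed
  have "summable (\<lambda>n. (A * q + E * A) * q ^ n)"
    using q by (intro summable_mult summable_geometric) auto
  then have "summable (\<lambda>n. ?g (Suc n) - ?g n)"
    by (rule summable_comparison_test') (rule step)
  then have "convergent (\<lambda>n. ?g n - ?g 0)"
    by (simp add: summable_iff_convergent sum_lessThan_telescope [of ?g])
  then obtain p0 where p0: "(\<lambda>n. ?g n - ?g 0) \<longlonglongrightarrow> p0"
    by (auto simp: convergent_def)
  define p where "p = p0 + ?g 0"
  have p: "?g \<longlonglongrightarrow> p"
    using tendsto_add [OF p0 tendsto_const [of "?g 0"]] by (simp add: p_def)
  have "p \<in> ?\<Gamma>"
    by (rule closed_sequentially [OF compact_imp_closed [OF compact_orbit] _ p]) (rule mem_orbit)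
  then obtain \<theta> where \<theta>: "p = \<gamma> \<theta>"
    by (auto simp: orbit_range)
  have Aq: "(\<lambda>n. A * q ^ n) \<longlonglongrightarrow> 0"
    using q by (intro tendsto_mult_right_zero LIMSEQ_power_zero) auto
  have "(\<lambda>n. dist (x (real n * T)) (?g n)) \<longlonglongrightarrow> 0"
    by (rule tendsto_sandwich [OF _ _ tendsto_const Aq]) (use xg in auto)
  moreover have "(\<lambda>n. dist (?g n) p) \<longlonglongrightarrow> 0"
    using p by (rule tendsto_dist_iff [THEN iffD1])
  ultimately have "(\<lambda>n. dist (x (real n * T)) (?g n) + dist (?g n) p) \<longlonglongrightarrow> 0 + 0"
    by (rule tendsto_add)
  then have "(\<lambda>n. E * (dist (x (real n * T)) (?g n) + dist (?g n) p)) \<longlonglongrightarrow> 0"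
    by (intro tendsto_mult_right_zero) simp
  moreover have "filterlim (\<lambda>t. nat \<lfloor>t / T\<rfloor>) sequentially at_top"
    unfolding filterlim_at_top eventually_at_top_linorder
  proof
    fix n
    show "\<exists>N. \<forall>t\<ge>N. n \<le> nat \<lfloor>t / T\<rfloor>"
      using T_pos by (intro exI [of _ "real n * T"]) (auto intro!: le_nat_floor simp: field_simps)
  qed
  ultimately have lim: "((\<lambda>t. E * (dist (x (real (nat \<lfloor>t / T\<rfloor>) * T)) (?g (nat \<lfloor>t / T\<rfloor>)) + dist (?g (nat \<lfloor>t / T\<rfloor>)) p)) \<longlongrightarrow> 0) at_top"
    by (rule filterlim_compose)
  \<comment> \<open>A general time is compared with the last multiple of \<open>T\<close> not after
    it, at the price of one more factor \<open>E\<close>.\<close>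
  have "dist (x t) (\<gamma> (t + \<theta>))
      \<le> E * (dist (x (real (nat \<lfloor>t / T\<rfloor>) * T)) (?g (nat \<lfloor>t / T\<rfloor>)) + dist (?g (nat \<lfloor>t / T\<rfloor>)) p)"
    if "t \<ge> 0" for t
  proof -
    let ?n = "nat \<lfloor>t / T\<rfloor>"
    have "real ?n * T \<le> t" "t \<le> real ?n * T + T"
      using T_pos \<open>t \<ge> 0\<close> floor_divide_lower [OF T_pos, of t] floor_divide_upper [OF T_pos, of t]
      by (auto simp: algebra_simps)
    then have "dist (x t) (\<gamma> (t + \<theta>)) \<le> E * dist (x (real ?n * T)) (\<gamma> (real ?n * T + \<theta>))"
      using T_pos by (intro close) auto
    also have "\<gamma> (real ?n * T + \<theta>) = p"
      using per_nat [of \<theta> ?n] by (simp add: \<theta> add.commute)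
    also have "E * dist (x (real ?n * T)) p \<le> E * (dist (x (real ?n * T)) (?g ?n) + dist (?g ?n) p)"
      using dist_triangle by (intro mult_left_mono) (auto simp: E_def)
    finally show ?thesis .
  qed
  then have "((\<lambda>t. dist (x t) (\<gamma> (t + \<theta>))) \<longlongrightarrow> 0) at_top"
    by (intro tendsto_sandwich [OF always_eventually eventually_at_top_linorderI [of 0] tendsto_const lim]) auto
  then show ?thesis
    by blast
qed

end

text \<open>\<open>F\<close> is a Lyapunov function. \<open>decay\<close> asks for a solution only
  on \<open>{0..t}\<close> and inside the tube, so it can be used before the solution is known to
  stay there; its conclusion \<open>x t \<in> W\<close> lets \<open>W\<close> be an open set or an
  invariant surface.\<close>

locale attracting_orbit = periodic_orbit X \<gamma> T
  for X :: "'a::euclidean_space \<Rightarrow> 'a" and \<gamma> T +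
  fixes W :: "'a set" and F :: "'a \<Rightarrow> real" and \<rho> L \<mu> :: real
  assumes \<rho>_pos: "\<rho> > 0" and \<mu>_pos: "\<mu> > 0"
    and lip: "L-lipschitz_on {u. infdist u (orbit_of \<gamma> T) \<le> \<rho>} X"
    and cont: "continuous_on {u. infdist u (orbit_of \<gamma> T) \<le> \<rho>} F"
    and F_orbit: "u \<in> orbit_of \<gamma> T \<Longrightarrow> F u = 0"
    and dominates: "infdist u (orbit_of \<gamma> T) \<le> \<rho> \<Longrightarrow> infdist u (orbit_of \<gamma> T) \<le> F u"
    and decay: "t \<ge> 0 \<Longrightarrow> x 0 \<in> W \<Longrightarrow> solution_on X {u. infdist u (orbit_of \<gamma> T) \<le> \<rho>} {0..t} x
      \<Longrightarrow> x t \<in> W \<and> F (x t) \<le> exp (- \<mu> * t) * F (x 0)"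
begin

text \<open>Uniform continuity on the compact tube compares \<open>u\<close> with its nearest orbit
  point, where \<open>F\<close> vanishes.\<close>

lemma F_small:
  assumes "\<epsilon> > 0"
  obtains \<delta> where "\<delta> > 0" "\<delta> \<le> \<rho>" "\<And>u. infdist u (orbit_of \<gamma> T) < \<delta> \<Longrightarrow> F u < \<epsilon>"
proof -
  have "compact {u. infdist u (orbit_of \<gamma> T) \<le> \<rho>}"
    by (rule compact_infdist_le [OF orbit_nonempty compact_orbit \<rho>_pos])
  then have "uniformly_continuous_on {u. infdist u (orbit_of \<gamma> T) \<le> \<rho>} F"
    by (rule compact_uniformly_continuous [OF cont])
  then obtain d where "d > 0" and d: "\<And>u v. infdist u (orbit_of \<gamma> T) \<le> \<rho> \<Longrightarrow>
      infdist v (orbit_of \<gamma> T) \<le> \<rho> \<Longrightarrow> dist u v < d \<Longrightarrow> dist (F u) (F v) < \<epsilon>"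
    unfolding uniformly_continuous_on_def using \<open>\<epsilon> > 0\<close> by (auto; metis)
  have "F u < \<epsilon>" if u: "infdist u (orbit_of \<gamma> T) < min d \<rho>" for u
  proof -
    obtain s where s: "infdist u (orbit_of \<gamma> T) = dist u (\<gamma> s)"
      by (rule nearest_point)
    then have "dist (F u) (F (\<gamma> s)) < \<epsilon>"
      using u mem_orbit [of s] \<rho>_pos by (intro d) auto
    then show ?thesis
      using F_orbit [OF mem_orbit] by (simp add: dist_real_def)
  qed
  then show thesis
    using \<open>d > 0\<close> \<rho>_pos by (intro that [of "min d \<rho>"]) auto
qed

text \<open>A bootstrap: as long as the cut-off solution stays within \<open>\<epsilon>\<close> it
  solves the original equation, so \<open>decay\<close> keeps it at distance at most
  \<open>F x0 < \<epsilon>\<close>, and this strict bound excludes a first exit.\<close>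

lemma attraction:
  assumes "0 < \<epsilon>" "\<epsilon> < \<rho>"
  obtains \<delta> where "\<delta> > 0"
    "\<And>x0. x0 \<in> W \<Longrightarrow> infdist x0 (orbit_of \<gamma> T) < \<delta> \<Longrightarrow>
      \<exists>x. forward_solution X W x0 x \<and> (\<forall>t\<ge>0. infdist (x t) (orbit_of \<gamma> T) < \<epsilon>) \<and>
        (\<forall>t\<ge>0. infdist (x t) (orbit_of \<gamma> T) \<le> F x0 * exp (- \<mu> * t))"
proof -
  let ?\<Gamma> = "orbit_of \<gamma> T"
  let ?K = "{u. infdist u ?\<Gamma> \<le> \<rho>}"
  obtain Y M B where Y: "M-lipschitz_on UNIV Y" "\<And>u. norm (Y u) \<le> B"
    "\<And>u. infdist u ?\<Gamma> \<le> \<epsilon> \<Longrightarrow> Y u = X u"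
    using lipschitz_cutoff [OF compact_orbit orbit_nonempty assms lip] by metis
  obtain \<delta> where "\<delta> > 0" "\<delta> \<le> \<rho>" and \<delta>: "\<And>u. infdist u ?\<Gamma> < \<delta> \<Longrightarrow> F u < \<epsilon>"
    using F_small [OF \<open>0 < \<epsilon>\<close>] by blast
  show thesis
  proof (rule that [OF \<open>\<delta> > 0\<close>])
    fix x0 assume "x0 \<in> W" and x0: "infdist x0 ?\<Gamma> < \<delta>"
    then have "infdist x0 ?\<Gamma> \<le> F x0" "F x0 < \<epsilon>"
      using dominates \<delta> \<open>\<delta> \<le> \<rho>\<close> by auto
    then have "F x0 \<ge> 0" "infdist x0 ?\<Gamma> < \<epsilon>"
      using infdist_nonneg [of x0 ?\<Gamma>] by linarith+
    obtain x where x: "x 0 = x0" "solution_on Y UNIV {0..} x"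
      using global_solution [OF Y(1,2)] unfolding forward_solution_def by blast
    have contx: "continuous_on {0..} x"
      using x(2) unfolding solution_on_def continuous_on_eq_continuous_within
      by (meson has_vector_derivative_continuous)
    have sol: "solution_on X ?K {0..t} x"
      if "\<And>s. s \<in> {0..t} \<Longrightarrow> infdist (x s) ?\<Gamma> \<le> \<epsilon>" for t
    proof (rule solution_on_cong [where X = Y and W = UNIV])
      show "solution_on Y UNIV {0..t} x"
        by (rule solution_on_mono [OF x(2)]) auto
      show "x s \<in> ?K \<and> Y (x s) = X (x s)" if "s \<in> {0..t}" for s
        using \<open>\<And>s. s \<in> {0..t} \<Longrightarrow> _\<close> [OF that] Y(3) \<open>\<epsilon> < \<rho>\<close> by auto
    qed
    have est: "x t \<in> W" "infdist (x t) ?\<Gamma> \<le> F x0 * exp (- \<mu> * t)" "infdist (x t) ?\<Gamma> < \<epsilon>"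
      if "t \<ge> 0" and le: "\<And>s. s \<in> {0..t} \<Longrightarrow> infdist (x s) ?\<Gamma> \<le> \<epsilon>" for t
    proof -
      have "x t \<in> W \<and> F (x t) \<le> exp (- \<mu> * t) * F (x 0)"
        using \<open>x0 \<in> W\<close> by (intro decay [OF \<open>t \<ge> 0\<close> _ sol]) (auto simp: x(1) le)
      then have *: "x t \<in> W" "F (x t) \<le> F x0 * exp (- \<mu> * t)"
        by (auto simp: x(1) mult.commute)
      have "infdist (x t) ?\<Gamma> \<le> F (x t)"
        using le [of t] \<open>t \<ge> 0\<close> \<open>\<epsilon> < \<rho>\<close> by (intro dominates) auto
      moreover have "F x0 * exp (- \<mu> * t) \<le> F x0 * 1"
        using \<open>F x0 \<ge> 0\<close> \<mu>_pos \<open>t \<ge> 0\<close> by (intro mult_left_mono) auto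
      ultimately show "x t \<in> W" "infdist (x t) ?\<Gamma> \<le> F x0 * exp (- \<mu> * t)" "infdist (x t) ?\<Gamma> < \<epsilon>"
        using * \<open>F x0 < \<epsilon>\<close> by auto
    qed
    have inside: "infdist (x t) ?\<Gamma> < \<epsilon>" if "t \<ge> 0" for t
    proof (rule ccontr)
      assume contra: "\<not> infdist (x t) ?\<Gamma> < \<epsilon>"
      let ?S = "{s \<in> {0..t}. \<epsilon> \<le> infdist (x s) ?\<Gamma>}"
      have cont_inf: "continuous_on {0..t} (\<lambda>s. infdist (x s) ?\<Gamma>)" for t
        by (intro continuous_intros continuous_on_subset [OF contx]) auto
      have "compact ?S"
        unfolding compact_eq_bounded_closed
      proof
        show "bounded ?S"
          by (rule bounded_subset [of "{0..t}"]) auto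
        show "closed ?S"
          using continuous_on_closed_Collect_le [OF continuous_on_const cont_inf closed_atLeastAtMost] .
      qed
      moreover have "t \<in> ?S"
        using contra that by auto
      ultimately obtain s where s: "s \<in> ?S" and min: "\<And>r. r \<in> ?S \<Longrightarrow> s \<le> r"
        using compact_attains_inf [of ?S] by auto
      \<comment> \<open>By the intermediate value theorem the distance is exactly
        \<open>\<epsilon>\<close> at the earliest time \<open>s\<close> in \<open>?S\<close>, so the
        hypothesis of \<open>est\<close> holds on \<open>{0..s}\<close> with the end point
        included.\<close>
      obtain r where r: "0 \<le> r" "r \<le> s" "infdist (x r) ?\<Gamma> = \<epsilon>"
        using IVT' [of "\<lambda>s. infdist (x s) ?\<Gamma>" 0 \<epsilon> s] s \<open>infdist x0 ?\<Gamma> < \<epsilon>\<close> cont_inf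
        by (auto simp: x(1))
      then have "s \<le> r"
        using s by (intro min) auto
      then have "infdist (x s) ?\<Gamma> = \<epsilon>"
        using r by simp
      moreover have "infdist (x r) ?\<Gamma> \<le> \<epsilon>" if "r \<in> {0..s}" for r
        using min [of r] that s \<open>infdist (x s) ?\<Gamma> = \<epsilon>\<close> by fastforce
      then have "infdist (x s) ?\<Gamma> < \<epsilon>"
        using s by (intro est(3)) auto
      ultimately show False
        by simp
    qed
    have "solution_on X W {0..} x"
    proof (rule solution_on_cong [OF x(2)])
      fix t :: real assume "t \<in> {0..}"
      then show "x t \<in> W \<and> Y (x t) = X (x t)"
        using inside Y(3) by (auto intro!: est(1) less_imp_le)
    qed
    then have "forward_solution X W x0 x"
      by (simp add: forward_solution_def x(1))
    moreover have "infdist (x t) ?\<Gamma> \<le> F x0 * exp (- \<mu> * t)" if "t \<ge> 0" for t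
      using inside that by (intro est(2)) (auto intro: less_imp_le)
    ultimately show "\<exists>x. forward_solution X W x0 x \<and> (\<forall>t\<ge>0. infdist (x t) ?\<Gamma> < \<epsilon>) \<and>
        (\<forall>t\<ge>0. infdist (x t) ?\<Gamma> \<le> F x0 * exp (- \<mu> * t))"
      using inside by blast
  qed
qed

lemma phase_asymptotically_stable: "orbitally_phase_asymptotically_stable X W \<gamma> T"
proof -
  let ?\<Gamma> = "orbit_of \<gamma> T"
  have "orbitally_stable X W ?\<Gamma>"
    unfolding orbitally_stable_def
  proof (intro allI impI)
    fix \<epsilon> :: real assume "\<epsilon> > 0"
    \<comment> \<open>\<open>attraction\<close> works only inside the tube, hence the cap at
      \<open>\<rho> / 2\<close>.\<close>
    then have *: "0 < min \<epsilon> (\<rho> / 2)" "min \<epsilon> (\<rho> / 2) < \<rho>"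
      using \<rho>_pos by auto
    show "\<exists>\<delta>>0. \<forall>x0\<in>W. infdist x0 ?\<Gamma> < \<delta> \<longrightarrow>
        (\<exists>x. forward_solution X W x0 x \<and> (\<forall>t>0. infdist (x t) ?\<Gamma> < \<epsilon>))"
      by (rule attraction [OF *]) (meson less_imp_le min_less_iff_conj)
  qed
  moreover obtain \<delta> where "\<delta> > 0" and \<delta>: "\<And>x0. x0 \<in> W \<Longrightarrow> infdist x0 ?\<Gamma> < \<delta> \<Longrightarrow>
      \<exists>x. forward_solution X W x0 x \<and> (\<forall>t\<ge>0. infdist (x t) ?\<Gamma> < \<rho> / 2) \<and>
        (\<forall>t\<ge>0. infdist (x t) ?\<Gamma> \<le> F x0 * exp (- \<mu> * t))"
    using attraction [of "\<rho> / 2"] \<rho>_pos by (metis field_sum_of_halves half_gt_zero less_add_same_cancel1)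
  have "\<exists>x \<theta>. forward_solution X W x0 x \<and> ((\<lambda>t. infdist (x t) ?\<Gamma>) \<longlongrightarrow> 0) at_top \<and>
      ((\<lambda>t. dist (x t) (\<gamma> (t + \<theta>))) \<longlongrightarrow> 0) at_top"
    if x0: "x0 \<in> W" "infdist x0 ?\<Gamma> < \<delta>" for x0
  proof -
    obtain x where x: "forward_solution X W x0 x" "\<And>t. t \<ge> 0 \<Longrightarrow> infdist (x t) ?\<Gamma> < \<rho> / 2"
      "\<And>t. t \<ge> 0 \<Longrightarrow> infdist (x t) ?\<Gamma> \<le> F x0 * exp (- \<mu> * t)"
      using \<delta> [OF x0] by blast
    have "solution_on X W {0..} x"
      using x(1) by (simp add: forward_solution_def)
    then have "solution_on X {u. infdist u ?\<Gamma> \<le> \<rho>} {0..} x"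
      by (rule solution_on_cong) (use x(2) \<rho>_pos in force)
    then obtain \<theta> where \<theta>: "((\<lambda>t. dist (x t) (\<gamma> (t + \<theta>))) \<longlongrightarrow> 0) at_top"
      using asymptotic_phase [OF less_imp_le [OF \<rho>_pos] lip _ \<mu>_pos x(3)] by blast
    have "((\<lambda>t. infdist (x t) ?\<Gamma>) \<longlongrightarrow> 0) at_top"
      by (rule tendsto_sandwich [OF _ _ tendsto_const \<theta>])
        (auto intro!: always_eventually infdist_nonneg infdist_le mem_orbit)
    then show ?thesis
      using x(1) \<theta> by blast
  qed
  ultimately show ?thesis
    unfolding orbitally_phase_asymptotically_stable_def orbitally_asymptotically_stable_def
    using \<open>\<delta> > 0\<close> by meson
qed

end

section \<open>Lipschitz functions, gradients and scalar linear equations\<close>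

text \<open>Only the existence of a constant matters; hiding it lets composite fields be treated by
  introduction rules alone.\<close>

abbreviation lipschitzian_on :: "'a::metric_space set \<Rightarrow> ('a \<Rightarrow> 'b::metric_space) \<Rightarrow> bool" where
  "lipschitzian_on K f \<equiv> \<exists>L. L-lipschitz_on K f"

lemma lipschitzian_on_continuous: "lipschitzian_on K f \<Longrightarrow> continuous_on K f"
  using lipschitz_on_continuous_on by blast

lemma lipschitzian_on_const: "lipschitzian_on K (\<lambda>_. c)"
  using lipschitz_on_constant by blast

lemma lipschitzian_on_add:
  fixes f g :: "'a::metric_space \<Rightarrow> 'b::real_normed_vector"
  shows "lipschitzian_on K f \<Longrightarrow> lipschitzian_on K g \<Longrightarrow> lipschitzian_on K (\<lambda>u. f u + g u)"
  using lipschitz_on_add by blast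

lemma lipschitzian_on_diff:
  fixes f g :: "'a::metric_space \<Rightarrow> 'b::real_normed_vector"
  shows "lipschitzian_on K f \<Longrightarrow> lipschitzian_on K g \<Longrightarrow> lipschitzian_on K (\<lambda>u. f u - g u)"
  using lipschitz_on_diff by blast

lemma lipschitzian_on_sum:
  fixes f :: "'i \<Rightarrow> 'a::metric_space \<Rightarrow> 'b::real_normed_vector"
  shows "(\<And>i. i \<in> I \<Longrightarrow> lipschitzian_on K (f i)) \<Longrightarrow> lipschitzian_on K (\<lambda>u. \<Sum>i\<in>I. f i u)"
  by (induction I rule: infinite_finite_induct) (auto intro: lipschitzian_on_const lipschitzian_on_add)

lemmas lipschitzian_on_mult = bounded_bilinear.lipschitz_on_prod [OF bounded_bilinear_mult]
lemmas lipschitzian_on_scaleR = bounded_bilinear.lipschitz_on_prod [OF bounded_bilinear_scaleR]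
lemmas lipschitzian_on_cross3 =
  bounded_bilinear.lipschitz_on_prod [OF bilinear_conv_bounded_bilinear [THEN iffD1, OF bilinear_cross]]

text \<open>Riesz representation in coordinates; it provides the existence behind the description
  operator in \<open>grad\<close>.\<close>

lemma GDERIV_grad:
  fixes f :: "'a::euclidean_space \<Rightarrow> real"
  assumes "f differentiable (at u)"
  shows "GDERIV f u :> grad f u"
proof -
  let ?D = "frechet_derivative f (at u)"
  have D: "(f has_derivative ?D) (at u)"
    using assms frechet_derivative_works by blast
  then interpret bounded_linear ?D
    by (rule has_derivative_bounded_linear)
  have "?D v = v \<bullet> (\<Sum>i\<in>Basis. ?D i *\<^sub>R i)" for v
  proof -
    have "?D v = (\<Sum>i\<in>Basis. (v \<bullet> i) *\<^sub>R ?D i)"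
      by (subst euclidean_representation [symmetric, of v]) (simp only: sum scaleR)
    then show ?thesis
      by (simp add: inner_sum_right mult.commute)
  qed
  then have "GDERIV f u :> (\<Sum>i\<in>Basis. ?D i *\<^sub>R i)"
    unfolding gderiv_def using D by (metis (no_types, lifting) ext)
  then show ?thesis
    using grad_eqI by metis
qed

text \<open>The coordinates of the gradient are the derivatives along basis vectors, of class C^1
  when \<open>f\<close> is of class C^2.\<close>

lemma lipschitzian_on_grad:
  fixes f :: "'a::euclidean_space \<Rightarrow> real"
  assumes "open S" and f: "Ck_on (Suc (Suc 0)) S f" and "compact K" "K \<subseteq> S"
  shows "lipschitzian_on K (grad f)"
proof -
  let ?D = "\<lambda>u. frechet_derivative f (at u)"
  have "?D u v = v \<bullet> grad f u" if "u \<in> S" for u v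
  proof -
    have "(f has_derivative (\<lambda>v. v \<bullet> grad f u)) (at u)"
      using GDERIV_grad [of f u] f that by (simp add: gderiv_def)
    then show ?thesis
      by (metis frechet_derivative_at)
  qed
  then have D: "(\<Sum>i\<in>Basis. ?D u i *\<^sub>R i) = grad f u" if "u \<in> K" for u
    using that \<open>K \<subseteq> S\<close> by (subst (2) euclidean_representation [symmetric])
      (auto intro!: sum.cong simp: inner_commute)
  have "lipschitzian_on K (\<lambda>u. ?D u i)" for i
    by (rule Ck_on_Suc_0_imp_lipschitz [OF \<open>open S\<close> _ \<open>compact K\<close> \<open>K \<subseteq> S\<close>]) (use f in auto)
  then have "lipschitzian_on K (\<lambda>u. \<Sum>i\<in>Basis. ?D u i *\<^sub>R i)"
    by (intro lipschitzian_on_sum lipschitzian_on_scaleR lipschitzian_on_const \<open>compact K\<close>)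
  then obtain L where "L-lipschitz_on K (\<lambda>u. \<Sum>i\<in>Basis. ?D u i *\<^sub>R i)"
    by blast
  then have "L-lipschitz_on K (grad f)"
    by (rule lipschitz_on_transform) (simp add: D)
  then show ?thesis
    by blast
qed

text \<open>Mean value inequality for \<open>f\<close> minus its linear part at \<open>p\<close>:
  the gradient varies by at most \<open>M * norm (u - p)\<close> along the segment, a crude bound
  without the Taylor factor 1/2.\<close>

lemma gradient_remainder:
  fixes f :: "'a::real_inner \<Rightarrow> real"
  assumes f: "\<And>v. v \<in> closed_segment p u \<Longrightarrow> GDERIV f v :> g v"
    and g: "M-lipschitz_on (closed_segment p u) g"
  shows "\<bar>f u - f p - (u - p) \<bullet> g p\<bar> \<le> M * (norm (u - p))\<^sup>2"
proof -
  have "norm (f u - f p - (u - p) \<bullet> g p) \<le> norm (u - p) * (M * norm (u - p))"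
  proof (rule differentiable_bound_linearization [where S = "closed_segment p u" and f' = "\<lambda>v h. h \<bullet> g v"])
    show "p + t *\<^sub>R (u - p) \<in> closed_segment p u" if "t \<in> {0..1}" for t
      using that unfolding in_segment by (intro exI [of _ t]) (auto simp: algebra_simps)
    fix v assume v: "v \<in> closed_segment p u"
    show "(f has_derivative (\<lambda>h. h \<bullet> g v)) (at v within closed_segment p u)"
      using f [OF v] unfolding gderiv_def by (rule has_derivative_at_withinI)
    have M: "norm (g v - g p) \<le> M * norm (u - p)"
    proof -
      have "norm (g v - g p) \<le> M * norm (v - p)"
        using lipschitz_on_normD [OF g v] by simp
      also have "\<dots> \<le> M * norm (u - p)"
        using segment_bound [OF v] lipschitz_on_nonneg [OF g] by (intro mult_left_mono) auto
      finally show ?thesis .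
    qed
    show "onorm ((\<lambda>h. h \<bullet> g v) - (\<lambda>h. h \<bullet> g p)) \<le> M * norm (u - p)"
    proof (rule onorm_bound)
      show "0 \<le> M * norm (u - p)"
        using lipschitz_on_nonneg [OF g] by simp
      fix h
      have "norm (h \<bullet> (g v - g p)) \<le> norm h * norm (g v - g p)"
        by (simp add: Cauchy_Schwarz_ineq2)
      also have "\<dots> \<le> norm h * (M * norm (u - p))"
        using M by (intro mult_left_mono) auto
      finally show "norm (((\<lambda>h. h \<bullet> g v) - (\<lambda>h. h \<bullet> g p)) h) \<le> M * norm (u - p) * norm h"
        by (simp add: inner_diff_right mult.commute)
    qed
  qed auto
  then show ?thesis
    by (simp add: power2_eq_square algebra_simps)
qed

section \<open>Scalar linear equations along solutions, and instability through growth\<close>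

lemma compact_positive_lower_bound:
  fixes f :: "'a::topological_space \<Rightarrow> real"
  assumes "compact K" "continuous_on K f" "\<And>u. u \<in> K \<Longrightarrow> f u > 0"
  obtains m where "m > 0" "\<And>u. u \<in> K \<Longrightarrow> m \<le> f u"
proof (cases "K = {}")
  case True
  then show thesis
    using that [of 1] by simp
next
  case False
  then show thesis
    using continuous_attains_inf [OF assms(1) False assms(2)] assms(3) that by blast
qed

text \<open>Squaring removes the sign of \<open>y\<close>. The bound \<open>m\<close> may have any
  sign; \<open>m = 0\<close> shows that a zero initial value persists.\<close>

lemma linear_ode_decay:
  fixes y k :: "real \<Rightarrow> real"
  assumes "0 \<le> t"
    and y: "\<And>s. s \<in> {0..t} \<Longrightarrow> (y has_real_derivative - k s * y s) (at s within {0..t})"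
    and k: "\<And>s. s \<in> {0..t} \<Longrightarrow> m \<le> k s"
  shows "\<bar>y t\<bar> \<le> exp (- m * t) * \<bar>y 0\<bar>"
proof -
  have "(y t)\<^sup>2 \<le> exp (- 2 * m * (t - 0)) * (y 0)\<^sup>2"
  proof (rule linear_growth_bound [where f' = "\<lambda>s. 2 * (- k s * y s) * y s", OF \<open>0 \<le> t\<close>])
    fix s assume s: "s \<in> {0..t}"
    show "((\<lambda>s. (y s)\<^sup>2) has_real_derivative 2 * (- k s * y s) * y s) (at s within {0..t})"
      by (rule derivative_eq_intros y s refl | simp add: algebra_simps)+
    show "2 * (- k s * y s) * y s \<le> - 2 * m * (y s)\<^sup>2"
      using mult_right_mono [OF k [OF s], of "(y s)\<^sup>2"] by (simp add: power2_eq_square algebra_simps)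
  qed
  also have "\<dots> = (exp (- m * t) * \<bar>y 0\<bar>)\<^sup>2"
    by (simp add: power_mult_distrib exp_double [symmetric] algebra_simps)
  finally show ?thesis
    by (simp add: power2_le_iff_abs_le)
qed

text \<open>The upper growth bound applied to \<open>- y^2\<close> is the lower bound wanted for
  \<open>y^2\<close>.\<close>

lemma linear_ode_growth:
  fixes y k :: "real \<Rightarrow> real"
  assumes "0 \<le> t"
    and y: "\<And>s. s \<in> {0..t} \<Longrightarrow> (y has_real_derivative k s * y s) (at s within {0..t})"
    and k: "\<And>s. s \<in> {0..t} \<Longrightarrow> m \<le> k s"
  shows "exp (m * t) * \<bar>y 0\<bar> \<le> \<bar>y t\<bar>"
proof -
  have "- (y t)\<^sup>2 \<le> exp (2 * m * (t - 0)) * (- (y 0)\<^sup>2)"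
  proof (rule linear_growth_bound [where f' = "\<lambda>s. - (2 * (k s * y s) * y s)", OF \<open>0 \<le> t\<close>])
    fix s assume s: "s \<in> {0..t}"
    show "((\<lambda>s. - (y s)\<^sup>2) has_real_derivative - (2 * (k s * y s) * y s)) (at s within {0..t})"
      by (rule derivative_eq_intros y s refl | simp add: algebra_simps)+
    show "- (2 * (k s * y s) * y s) \<le> 2 * m * (- (y s)\<^sup>2)"
      using mult_right_mono [OF k [OF s], of "(y s)\<^sup>2"] by (simp add: power2_eq_square algebra_simps)
  qed
  also have "exp (2 * m * (t - 0)) * (- (y 0)\<^sup>2) = - (exp (m * t) * \<bar>y 0\<bar>)\<^sup>2"
    by (simp add: power_mult_distrib exp_double [symmetric] algebra_simps)
  finally have "(exp (m * t) * \<bar>y 0\<bar>)\<^sup>2 \<le> \<bar>y t\<bar>\<^sup>2"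
    by simp
  then show ?thesis
    by (rule power2_le_imp_le) simp
qed

lemma GDERIV_along_solution:
  assumes "solution_on X W I x" "t \<in> I" "GDERIV f (x t) :> D"
  shows "((\<lambda>t. f (x t)) has_real_derivative X (x t) \<bullet> D) (at t within I)"
proof -
  have "(x has_derivative (\<lambda>h. h *\<^sub>R X (x t))) (at t within I)"
    using assms(1,2) unfolding solution_on_def has_vector_derivative_def by auto
  then have "(f \<circ> x has_derivative (\<lambda>v. v \<bullet> D) \<circ> (\<lambda>h. h *\<^sub>R X (x t))) (at t within I)"
    by (rule diff_chain_within) (use assms(3) in \<open>auto simp: gderiv_def intro: has_derivative_at_withinI\<close>)
  then show ?thesis
    unfolding has_field_derivative_def comp_def
    by (rule has_derivative_eq_rhs) (auto simp: mult.commute)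
qed

lemma growing_function_unstable:
  fixes X :: "'a::real_inner \<Rightarrow> 'a" and g :: "'a \<Rightarrow> real"
  assumes "\<rho> > 0" and K: "compact {u. infdist u \<Gamma> \<le> \<rho>}"
    and g: "continuous_on {u. infdist u \<Gamma> \<le> \<rho>} g"
    and k: "continuous_on {u. infdist u \<Gamma> \<le> \<rho>} k" "\<And>u. infdist u \<Gamma> \<le> \<rho> \<Longrightarrow> k u > 0"
    and deriv: "\<And>x t s. solution_on X V {0..t} x \<Longrightarrow> s \<in> {0..t} \<Longrightarrow>
      ((\<lambda>s. g (x s)) has_real_derivative k (x s) * g (x s)) (at s within {0..t})"
    and nonzero: "\<And>\<delta>. \<delta> > 0 \<Longrightarrow> \<exists>u\<in>V. infdist u \<Gamma> < \<delta> \<and> g u \<noteq> 0"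
  shows "\<not> orbitally_stable X V \<Gamma>"
proof
  let ?K = "{u. infdist u \<Gamma> \<le> \<rho>}"
  assume "orbitally_stable X V \<Gamma>"
  then obtain \<delta> where "\<delta> > 0" and \<delta>: "\<And>x0. x0 \<in> V \<Longrightarrow> infdist x0 \<Gamma> < \<delta> \<Longrightarrow>
      \<exists>x. forward_solution X V x0 x \<and> (\<forall>t>0. infdist (x t) \<Gamma> < \<rho>)"
    unfolding orbitally_stable_def using \<open>\<rho> > 0\<close> by meson
  \<comment> \<open>Stability controls \<open>t > 0\<close> only; the minimum also puts the starting
    point itself into the tube.\<close>
  obtain x0 where x0: "x0 \<in> V" "infdist x0 \<Gamma> < min \<delta> \<rho>" "g x0 \<noteq> 0"
    using nonzero [of "min \<delta> \<rho>"] \<open>\<delta> > 0\<close> \<open>\<rho> > 0\<close> by auto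
  then obtain x where x: "x 0 = x0" "solution_on X V {0..} x" "\<And>t. t > 0 \<Longrightarrow> infdist (x t) \<Gamma> < \<rho>"
    using \<delta> [of x0] unfolding forward_solution_def by auto
  have xK: "infdist (x t) \<Gamma> \<le> \<rho>" if "t \<ge> 0" for t
    using x(1,3) x0(2) that by (cases "t = 0") (auto intro: less_imp_le)
  obtain m where "m > 0" and m: "\<And>u. u \<in> ?K \<Longrightarrow> m \<le> k u"
    by (rule compact_positive_lower_bound [OF K k(1)]) (use k(2) in auto)
  obtain B where B: "\<And>u. u \<in> ?K \<Longrightarrow> \<bar>g u\<bar> \<le> B"
    using compact_imp_bounded [OF compact_continuous_image [OF g K]] unfolding bounded_iff by auto
  have growth: "exp (m * t) * \<bar>g x0\<bar> \<le> B" if "t \<ge> 0" for t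
  proof -
    have "solution_on X V {0..t} x"
      by (rule solution_on_mono [OF x(2)]) auto
    from deriv [OF this] have "exp (m * t) * \<bar>g (x 0)\<bar> \<le> \<bar>g (x t)\<bar>"
      by (rule linear_ode_growth [OF that]) (use m xK in auto)
    also have "\<dots> \<le> B"
      using B xK that by auto
    finally show ?thesis
      by (simp add: x(1))
  qed
  have "B \<ge> 0"
    using growth [of 0] by simp
  \<comment> \<open>Chosen so that \<open>1 + m * t \<le> exp (m * t)\<close> already contradicts
    the bound \<open>B\<close>.\<close>
  define t where "t = B / (m * \<bar>g x0\<bar>)"
  have "t \<ge> 0" and "m * t * \<bar>g x0\<bar> = B"
    using \<open>B \<ge> 0\<close> \<open>m > 0\<close> x0(3) by (auto simp: t_def)
  have "(1 + m * t) * \<bar>g x0\<bar> \<le> exp (m * t) * \<bar>g x0\<bar>"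
    by (intro mult_right_mono exp_ge_add_one_self) auto
  then have "\<bar>g x0\<bar> + B \<le> B"
    using growth [OF \<open>t \<ge> 0\<close>] \<open>m * t * \<bar>g x0\<bar> = B\<close> by (simp add: distrib_right)
  then show False
    using x0(3) by simp
qed

text \<open>Supplies starting points off a level set: a function constant near \<open>p\<close>
  would have zero derivative there.\<close>

lemma GDERIV_nonzero_imp_nonconstant_near:
  assumes "GDERIV f p :> D" "D \<noteq> 0" "open S" "p \<in> S"
  shows "\<exists>u\<in>S. f u \<noteq> c"
proof (rule ccontr)
  assume "\<not> ?thesis"
  then have "((\<lambda>_. c) has_derivative (\<lambda>h. h \<bullet> D)) (at p)"
    by (intro has_derivative_transform_within_open
        [OF assms(1) [unfolded gderiv_def] \<open>open S\<close> \<open>p \<in> S\<close>]) auto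
  then have "(\<lambda>h. h \<bullet> D) = (\<lambda>_. 0)"
    by (rule has_derivative_unique) (rule has_derivative_const)
  then have "D \<bullet> D = 0"
    by (rule fun_cong)
  then show False
    using \<open>D \<noteq> 0\<close> by simp
qed

text \<open>With \<open>a\<close> and \<open>b\<close> the gradients of \<open>H\<close> and
  \<open>C\<close>, the opposite signs explain why the two damping terms of the attracting system
  carry opposite signs.\<close>

lemma inner_grad_identities:
  fixes a b :: "real^3"
  shows "a \<bullet> (b \<times> (a \<times> b)) = (a \<times> b) \<bullet> (a \<times> b)" "b \<bullet> (a \<times> (a \<times> b)) = - ((a \<times> b) \<bullet> (a \<times> b))"
  by (simp_all add: cross3_simps)

text \<open>Up to the factor \<open>1 / (n \<bullet> n)\<close>, with
  \<open>n = a \<times> b\<close>, the three vectors on the right form the basis dual to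
  \<open>a\<close>, \<open>b\<close>, \<open>n\<close>.\<close>

lemma cross3_frame_expansion:
  fixes a b w :: "real^3"
  shows "((a \<times> b) \<bullet> (a \<times> b)) *\<^sub>R w = (w \<bullet> a) *\<^sub>R (b \<times> (a \<times> b)) + (w \<bullet> b) *\<^sub>R ((a \<times> b) \<times> a)
    + (w \<bullet> (a \<times> b)) *\<^sub>R (a \<times> b)"
  by (simp add: cross3_simps forall_3)

lemma norm_cross3_le: "norm (a \<times> b) \<le> norm a * norm b" for a b :: "real^3"
proof -
  have "(norm (a \<times> b))\<^sup>2 \<le> (norm a * norm b)\<^sup>2"
    using norm_cross_dot [of a b] by (smt (verit) zero_le_power2)
  then show ?thesis
    by (rule power2_le_imp_le) simp
qed

text \<open>Quantitative injectivity of \<open>w \<mapsto> (w \<bullet> a, w \<bullet> b)\<close> on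
  the plane orthogonal to \<open>a \<times> b\<close>, read off from the dual frame.\<close>

lemma norm_le_transversal:
  fixes a b w :: "real^3"
  assumes "w \<bullet> (a \<times> b) = 0"
  shows "norm (a \<times> b) * norm w \<le> \<bar>w \<bullet> a\<bar> * norm b + \<bar>w \<bullet> b\<bar> * norm a"
proof (cases "a \<times> b = 0")
  case False
  let ?n = "a \<times> b"
  have "norm ?n * (norm ?n * norm w) = norm ((w \<bullet> a) *\<^sub>R (b \<times> ?n) + (w \<bullet> b) *\<^sub>R (?n \<times> a))"
    using arg_cong [OF cross3_frame_expansion [of a b w], of norm] assms
    by (simp add: dot_square_norm power2_eq_square mult.assoc)
  also have "\<dots> \<le> \<bar>w \<bullet> a\<bar> * (norm b * norm ?n) + \<bar>w \<bullet> b\<bar> * (norm ?n * norm a)"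
    by (rule order_trans [OF norm_triangle_ineq]) (auto intro!: add_mono mult_left_mono norm_cross3_le)
  also have "\<dots> = norm ?n * (\<bar>w \<bullet> a\<bar> * norm b + \<bar>w \<bullet> b\<bar> * norm a)"
    by (simp add: algebra_simps)
  finally show ?thesis
    using False by (simp add: mult_le_cancel_left_pos)
qed simp

section \<open>Perturbed Hamiltonian fields\<close>

lemma independent_imp_cross3_nonzero:
  fixes a b :: "real^3"
  assumes "independent {a, b}" "a \<noteq> b"
  shows "a \<times> b \<noteq> 0"
proof
  assume "a \<times> b = 0"
  \<comment> \<open>Exchanged factors make collinearity produce \<open>a\<close> as a multiple of
    \<open>b\<close>, the form that independence refutes.\<close>
  then have "b \<times> a = 0"
    by (simp add: cross_skew [of b a])
  then have "b = 0 \<or> a = 0 \<or> (\<exists>k. a = k *\<^sub>R b)"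
    unfolding cross_eq_0 collinear_lemma .
  moreover have "0 \<notin> {a, b}"
    using assms dependent_zero by blast
  moreover have "a \<notin> span {b}"
    using assms independent_insert [of a "{b}"] by (simp split: if_splits)
  moreover have "k *\<^sub>R b \<in> span {b}" for k
    by (rule span_scale) (rule span_base, simp)
  ultimately show False
    by (elim disjE exE) simp_all
qed

text \<open>All systems of the theorem at once: sign changes go into \<open>a\<close> and
  \<open>b\<close>, and \<open>b = 0\<close> drops the second perturbation. The signs are arranged
  so that positive \<open>a\<close> and \<open>b\<close> damp.\<close>

definition perturbed_field :: "(real^3 \<Rightarrow> real) \<Rightarrow> (real^3 \<Rightarrow> real) \<Rightarrow> (real^3 \<Rightarrow> real) \<Rightarrow> real \<Rightarrow> real \<Rightarrow>
    (real^3 \<Rightarrow> real) \<Rightarrow> (real^3 \<Rightarrow> real) \<Rightarrow> real^3 \<Rightarrow> real^3" where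
  "perturbed_field \<nu> H C h c a b u =
     ham_field \<nu> H C u - (a u * (H u - h)) *\<^sub>R C_part H C u + (b u * (C u - c)) *\<^sub>R H_part H C u"

text \<open>\<open>n\<close> is orthogonal to both gradients and each perturbation direction to one
  of them, so the two equations decouple.\<close>

lemma inner_grad_perturbed_field:
  "grad H u \<bullet> perturbed_field \<nu> H C h c a b u
     = - (a u * (grad H u \<times> grad C u \<bullet> (grad H u \<times> grad C u))) * (H u - h)"
  "grad C u \<bullet> perturbed_field \<nu> H C h c a b u
     = - (b u * (grad H u \<times> grad C u \<bullet> (grad H u \<times> grad C u))) * (C u - c)"
  using inner_grad_identities [where a = "grad H u" and b = "grad C u"]
  by (simp_all add: perturbed_field_def ham_field_def C_part_def H_part_def dot_cross_self
      inner_add_right inner_diff_right)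

locale hamiltonian_orbit =
  fixes U V :: "(real^3) set" and H C \<nu> :: "real^3 \<Rightarrow> real" and h c T :: real
    and \<gamma> :: "real \<Rightarrow> real^3"
  assumes open_U: "open U" and open_V: "open V" and V_U: "V \<subseteq> U"
    and smooth: "smooth_on U H" "smooth_on U C" "smooth_on U \<nu>"
    and indep: "functionally_independent_on V H C"
    and periodic: "periodic_solution (ham_field \<nu> H C) U \<gamma> T"
    and orbit_V: "orbit_of \<gamma> T \<subseteq> V"
    and orbit_level: "orbit_of \<gamma> T \<subseteq> {u \<in> U. (H u, C u) = (h, c)}"
begin

abbreviation "\<Gamma> \<equiv> orbit_of \<gamma> T"
abbreviation "n u \<equiv> grad H u \<times> grad C u"
abbreviation "X \<equiv> perturbed_field \<nu> H C h c"

lemma GDERIV_H: "u \<in> V \<Longrightarrow> GDERIV H u :> grad H u"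
  and GDERIV_C: "u \<in> V \<Longrightarrow> GDERIV C u :> grad C u"
  using smooth V_U by (auto intro!: GDERIV_grad simp: smooth_on_def dest!: spec [of _ "Suc 0"])

lemma n_nonzero: "u \<in> V \<Longrightarrow> n u \<noteq> 0"
  using indep by (simp add: functionally_independent_on_def independent_imp_cross3_nonzero)

lemma lipschitzian_data:
  assumes "compact K" "K \<subseteq> V"
  shows "lipschitzian_on K H" "lipschitzian_on K C" "lipschitzian_on K \<nu>"
    "lipschitzian_on K (grad H)" "lipschitzian_on K (grad C)" "lipschitzian_on K n"
proof -
  have "K \<subseteq> U"
    using assms V_U by blast
  then show "lipschitzian_on K H" "lipschitzian_on K C" "lipschitzian_on K \<nu>"
    using smooth Ck_on_Suc_0_imp_lipschitz [OF open_U _ \<open>compact K\<close>] unfolding smooth_on_def by blast+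
  show *: "lipschitzian_on K (grad H)" "lipschitzian_on K (grad C)"
    using smooth lipschitzian_on_grad [OF open_U _ \<open>compact K\<close> \<open>K \<subseteq> U\<close>] unfolding smooth_on_def by blast+
  show "lipschitzian_on K n"
    by (intro lipschitzian_on_cross3 * \<open>compact K\<close>)
qed

lemma lipschitzian_X:
  assumes "compact K" "K \<subseteq> V" "lipschitzian_on K a" "lipschitzian_on K b"
  shows "lipschitzian_on K (X a b)"
  unfolding perturbed_field_def [abs_def] ham_field_def C_part_def H_part_def
  by (intro lipschitzian_on_add lipschitzian_on_diff lipschitzian_on_scaleR lipschitzian_on_mult
      lipschitzian_on_cross3 lipschitzian_on_const lipschitzian_data assms)

sublocale periodic_orbit "ham_field \<nu> H C" \<gamma> T
  using periodic unfolding periodic_solution_def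
  by unfold_locales (auto intro: solution_on_mono)

lemma on_orbit: "u \<in> \<Gamma> \<Longrightarrow> u \<in> V" "u \<in> \<Gamma> \<Longrightarrow> H u = h" "u \<in> \<Gamma> \<Longrightarrow> C u = c"
  using orbit_V orbit_level by auto

text \<open>The factors \<open>H - h\<close> and \<open>C - c\<close> vanish on \<Gamma>, so all
  perturbed fields coincide there with the Hamiltonian one.\<close>

lemma X_orbit: "u \<in> \<Gamma> \<Longrightarrow> X a b u = \<nu> u *\<^sub>R n u"
  by (simp add: perturbed_field_def on_orbit ham_field_def)

lemma \<gamma>_solution: "solution_on (X a b) V UNIV \<gamma>"
proof (rule solution_on_cong)
  show "solution_on (ham_field \<nu> H C) U UNIV \<gamma>"
    using periodic by (simp add: periodic_solution_def)
  show "\<gamma> t \<in> V \<and> ham_field \<nu> H C (\<gamma> t) = X a b (\<gamma> t)" for t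
    using mem_orbit [of t] by (simp add: on_orbit(1) X_orbit ham_field_def)
qed

lemma periodic_X: "periodic_solution (X a b) V \<gamma> T"
  using periodic \<gamma>_solution by (simp add: periodic_solution_def)

lemma periodic_orbit_X: "periodic_orbit (X a b) \<gamma> T"
  using periodic_X [of a b] unfolding periodic_solution_def
  by unfold_locales (auto intro: solution_on_mono)

section \<open>Tubes around the orbit and the distance estimate\<close>

lemma tube: obtains \<rho> where "\<rho> > 0" "{u. infdist u \<Gamma> \<le> \<rho>} \<subseteq> V"
proof -
  obtain e where "e > 0" and e: "(\<Union>u\<in>\<Gamma>. cball u e) \<subseteq> V"
    using compact_subset_open_imp_cball_epsilon_subset [OF compact_orbit open_V orbit_V] .
  have "u \<in> V" if "infdist u \<Gamma> \<le> e" for u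
  proof -
    obtain s where "infdist u \<Gamma> = dist u (\<gamma> s)"
      by (rule nearest_point)
    then have "u \<in> cball (\<gamma> s) e"
      using that by (simp add: dist_commute)
    then show ?thesis
      using e mem_orbit by blast
  qed
  then show thesis
    using that \<open>e > 0\<close> by blast
qed

lemma compact_tube: "\<rho> > 0 \<Longrightarrow> compact {u. infdist u \<Gamma> \<le> \<rho>}"
  using compact_infdist_le [OF orbit_nonempty compact_orbit] .

text \<open>Were \<open>\<nu>\<close> to vanish on the orbit, uniqueness of solutions would make \<open>\<gamma>\<close> constant.\<close>

lemma \<nu>_nonzero: "\<nu> (\<gamma> s) \<noteq> 0"
proof
  assume "\<nu> (\<gamma> s) = 0"
  \<comment> \<open>With zero coefficients this is the Hamiltonian field itself, in the form covered
    by \<open>lipschitzian_X\<close>.\<close>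
  let ?X = "X (\<lambda>_. 0) (\<lambda>_. 0)"
  have "lipschitzian_on \<Gamma> ?X"
    by (intro lipschitzian_X lipschitzian_on_const compact_orbit orbit_V)
  then obtain L where L: "L-lipschitz_on \<Gamma> ?X"
    by blast
  have eq: "\<gamma> t = \<gamma> s" if "s \<le> t" for t
  proof -
    have "solution_on ?X \<Gamma> {s..t} \<gamma>"
      by (rule solution_on_cong [where X = ?X and W = V])
        (auto intro: solution_on_mono [OF \<gamma>_solution] mem_orbit)
    moreover have "solution_on ?X \<Gamma> {s..t} (\<lambda>_. \<gamma> s)"
      using \<open>\<nu> (\<gamma> s) = 0\<close> mem_orbit by (simp add: solution_on_def X_orbit)
    ultimately show ?thesis
      using solution_dist_le [OF L that, of \<gamma> "\<lambda>_. \<gamma> s"] by simp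
  qed
  have "\<gamma> t = \<gamma> s" for t
  proof -
    \<comment> \<open>The comparison runs forward from \<open>s\<close>; earlier times are moved
      past \<open>s\<close> by whole periods.\<close>
    obtain k :: nat where "s - t \<le> real k * T"
      using reals_Archimedean3 [OF T_pos] less_imp_le by blast
    then have "\<gamma> (t + real k * T) = \<gamma> s"
      by (intro eq) simp
    then show ?thesis
      using per_nat [of t k] by simp
  qed
  then show False
    using periodic unfolding periodic_solution_def by metis
qed

text \<open>The squared distance from \<open>u\<close> to \<open>\<gamma> t\<close> is minimal at
  \<open>s\<close>, so its derivative vanishes there; \<open>\<nu>_nonzero\<close> then strips the
  factor from the velocity.\<close>

lemma nearest_point_orthogonal:
  assumes "infdist u \<Gamma> = dist u (\<gamma> s)"
  shows "(u - \<gamma> s) \<bullet> n (\<gamma> s) = 0"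
proof -
  let ?v = "\<nu> (\<gamma> s) *\<^sub>R n (\<gamma> s)"
  have "(\<gamma> has_vector_derivative ?v) (at s)"
    using deriv [of s] by (simp add: ham_field_def)
  then have d: "((\<lambda>t. u - \<gamma> t) has_derivative (\<lambda>h. - (h *\<^sub>R ?v))) (at s)"
    unfolding has_vector_derivative_def by (auto intro!: derivative_eq_intros)
  have "((\<lambda>t. (u - \<gamma> t) \<bullet> (u - \<gamma> t)) has_real_derivative - 2 * ((u - \<gamma> s) \<bullet> ?v)) (at s)"
    unfolding has_field_derivative_def
    by (rule has_derivative_eq_rhs [OF has_derivative_inner [OF d d]])
      (auto simp: inner_commute algebra_simps)
  moreover have "(u - \<gamma> s) \<bullet> (u - \<gamma> s) \<le> (u - \<gamma> t) \<bullet> (u - \<gamma> t)" for t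
  proof -
    have "dist u (\<gamma> s) \<le> dist u (\<gamma> t)"
      using infdist_le [OF mem_orbit [of t], of u] assms by simp
    then show ?thesis
      by (simp add: dot_square_norm dist_norm power_mono)
  qed
  ultimately have "- 2 * ((u - \<gamma> s) \<bullet> ?v) = 0"
    by (rule_tac DERIV_local_min [where d = 1]) auto
  then show ?thesis
    using \<nu>_nonzero [of s] by simp
qed

text \<open>The displacement \<open>w\<close> from the nearest point of the orbit is orthogonal to the orbit, hence lies in the
  span of the two gradients; to first order \<open>(H, C)\<close> is therefore injective in \<open>w\<close>.\<close>

lemma infdist_le_level:
  obtains \<rho> \<kappa> where "\<rho> > 0" "\<kappa> > 0" "{u. infdist u \<Gamma> \<le> \<rho>} \<subseteq> V"
    "\<And>u. infdist u \<Gamma> \<le> \<rho> \<Longrightarrow> infdist u \<Gamma> \<le> \<kappa> * (\<bar>H u - h\<bar> + \<bar>C u - c\<bar>)"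
proof -
  obtain r where "r > 0" and r: "{u. infdist u \<Gamma> \<le> r} \<subseteq> V"
    by (rule tube)
  let ?K = "{u. infdist u \<Gamma> \<le> r}"
  have K: "compact ?K"
    using \<open>r > 0\<close> by (rule compact_tube)
  note lip = lipschitzian_data [OF K r]
  have "continuous_on ?K (\<lambda>u. norm (n u))"
    by (intro continuous_intros lipschitzian_on_continuous lip)
  then obtain m where "m > 0" and m: "\<And>u. u \<in> ?K \<Longrightarrow> m \<le> norm (n u)"
    by (rule compact_positive_lower_bound [OF K]) (use n_nonzero r in auto)
  have "bounded (grad H ` ?K)" "bounded (grad C ` ?K)"
    by (intro compact_imp_bounded compact_continuous_image lipschitzian_on_continuous lip K)+
  then obtain A1 A2 where "A1 > 0" and A1: "\<And>u. u \<in> ?K \<Longrightarrow> norm (grad H u) \<le> A1"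
    and A2: "\<And>u. u \<in> ?K \<Longrightarrow> norm (grad C u) \<le> A2"
    unfolding bounded_pos by auto
  define A where "A = max A1 A2"
  have "A > 0" and A: "\<And>u. u \<in> ?K \<Longrightarrow> norm (grad H u) \<le> A" "\<And>u. u \<in> ?K \<Longrightarrow> norm (grad C u) \<le> A"
    using \<open>A1 > 0\<close> A1 A2 by (auto simp: A_def le_max_iff_disj)
  obtain M1 M2 where M1: "M1-lipschitz_on ?K (grad H)" and M2: "M2-lipschitz_on ?K (grad C)"
    using lip(4,5) by blast
  \<comment> \<open>The added 1 makes \<open>M\<close> positive, as \<open>M\<close> occurs in a
    divisor below.\<close>
  define M where "M = max M1 M2 + 1"
  have "M > 0" and M: "M-lipschitz_on ?K (grad H)" "M-lipschitz_on ?K (grad C)"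
    using lipschitz_on_nonneg [OF M1] lipschitz_on_mono [OF M1] lipschitz_on_mono [OF M2]
    by (auto simp: M_def)
  \<comment> \<open>This radius makes the quadratic error \<open>2 * A * M * norm w * norm w\<close>
    at most half of \<open>m * norm w\<close>; absorbing it yields the factor
    \<open>2 * A / m\<close> for \<open>\<kappa>\<close>.\<close>
  define \<rho> where "\<rho> = min r (m / (4 * A * M))"
  show thesis
  proof
    show "\<rho> > 0" "2 * A / m > 0"
      using \<open>r > 0\<close> \<open>m > 0\<close> \<open>A > 0\<close> \<open>M > 0\<close> by (auto simp: \<rho>_def)
    show "{u. infdist u \<Gamma> \<le> \<rho>} \<subseteq> V"
      using r by (auto simp: \<rho>_def)
    fix u assume u: "infdist u \<Gamma> \<le> \<rho>"
    obtain s where s: "infdist u \<Gamma> = dist u (\<gamma> s)"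
      by (rule nearest_point)
    let ?p = "\<gamma> s" and ?E = "\<bar>H u - h\<bar> + \<bar>C u - c\<bar>"
    define w where "w = u - ?p"
    have w: "norm w = infdist u \<Gamma>"
      by (simp add: s w_def dist_norm)
    have "?p \<in> ?K"
      using mem_orbit \<open>r > 0\<close> by simp
    \<comment> \<open>Points between \<open>?p\<close> and \<open>u\<close> are no farther from
      \<open>?p\<close> than \<open>u\<close>, so the first-order estimate never leaves the
      tube.\<close>
    have seg: "closed_segment ?p u \<subseteq> ?K"
    proof
      fix v assume "v \<in> closed_segment ?p u"
      then have "dist v ?p \<le> dist u ?p"
        using segment_bound(1) by (simp add: dist_norm)
      then show "v \<in> ?K"
        using infdist_le [OF mem_orbit [of s], of v] u s by (simp add: \<rho>_def dist_commute)
    qed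
    have "\<bar>H u - H ?p - w \<bullet> grad H ?p\<bar> \<le> M * (norm w)\<^sup>2" "\<bar>C u - C ?p - w \<bullet> grad C ?p\<bar> \<le> M * (norm w)\<^sup>2"
      unfolding w_def using seg r
      by (auto intro!: gradient_remainder GDERIV_H GDERIV_C lipschitz_on_subset [OF M(1) seg]
          lipschitz_on_subset [OF M(2) seg])
    then have grads: "\<bar>w \<bullet> grad H ?p\<bar> + \<bar>w \<bullet> grad C ?p\<bar> \<le> ?E + 2 * (M * (norm w)\<^sup>2)"
      using on_orbit(2,3) [OF mem_orbit [of s]] by linarith
    have "norm (n ?p) * norm w \<le> \<bar>w \<bullet> grad H ?p\<bar> * norm (grad C ?p) + \<bar>w \<bullet> grad C ?p\<bar> * norm (grad H ?p)"
      by (rule norm_le_transversal) (simp add: w_def nearest_point_orthogonal [OF s])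
    also have "\<dots> \<le> \<bar>w \<bullet> grad H ?p\<bar> * A + \<bar>w \<bullet> grad C ?p\<bar> * A"
      using A [OF \<open>?p \<in> ?K\<close>] by (intro add_mono mult_left_mono) auto
    also have "\<dots> \<le> (?E + 2 * (M * (norm w)\<^sup>2)) * A"
      using mult_right_mono [OF grads, of A] \<open>A > 0\<close> by (simp add: algebra_simps)
    finally have "m * norm w \<le> ?E * A + 2 * A * M * norm w * norm w"
      using mult_right_mono [OF m [OF \<open>?p \<in> ?K\<close>], of "norm w"]
      by (simp add: power2_eq_square algebra_simps)
    moreover have "4 * A * M * norm w \<le> m"
    proof -
      have "norm w \<le> m / (4 * A * M)"
        using u w by (simp add: \<rho>_def)
      then show ?thesis
        using \<open>A > 0\<close> \<open>M > 0\<close> by (simp add: field_simps)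
    qed
    from mult_right_mono [OF this, of "norm w"] have "4 * A * M * norm w * norm w \<le> m * norm w"
      by simp
    ultimately have "m * norm w \<le> 2 * A * ?E"
      by (simp add: algebra_simps)
    then show "infdist u \<Gamma> \<le> 2 * A / m * ?E"
      using \<open>m > 0\<close> w by (simp add: field_simps)
  qed
qed

section \<open>Stability and instability of the perturbed systems\<close>

abbreviation "N u \<equiv> n u \<bullet> n u"

lemma level_derivs:
  assumes "solution_on (X a b) V I x" "t \<in> I"
  shows "((\<lambda>t. H (x t) - h) has_real_derivative - (a (x t) * N (x t)) * (H (x t) - h)) (at t within I)"
    and "((\<lambda>t. C (x t) - c) has_real_derivative - (b (x t) * N (x t)) * (C (x t) - c)) (at t within I)"
proof -
  have "x t \<in> V"
    using assms by (simp add: solution_on_def)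
  then show "((\<lambda>t. H (x t) - h) has_real_derivative - (a (x t) * N (x t)) * (H (x t) - h)) (at t within I)"
    and "((\<lambda>t. C (x t) - c) has_real_derivative - (b (x t) * N (x t)) * (C (x t) - c)) (at t within I)"
    using DERIV_diff [OF GDERIV_along_solution [OF assms GDERIV_H] DERIV_const [of h]]
      DERIV_diff [OF GDERIV_along_solution [OF assms GDERIV_C] DERIV_const [of c]]
    by (simp_all add: inner_grad_perturbed_field inner_commute [of "X a b (x t)"])
qed

lemma continuous_rate:
  assumes "compact K" "K \<subseteq> V" "lipschitzian_on K a"
  shows "continuous_on K (\<lambda>u. a u * N u)"
  by (intro continuous_intros lipschitzian_on_continuous lipschitzian_data assms)

lemma rate_pos: "u \<in> V \<Longrightarrow> N u > 0"
  using n_nonzero by simp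

text \<open>The two alternatives for \<open>W\<close> serve perturbations in the open set
  \<open>V\<close> and perturbations along the level set of \<open>C\<close>.\<close>

lemma stable:
  assumes lip: "\<And>K. compact K \<Longrightarrow> K \<subseteq> V \<Longrightarrow> lipschitzian_on K a"
      "\<And>K. compact K \<Longrightarrow> K \<subseteq> V \<Longrightarrow> lipschitzian_on K b"
    and pos: "\<And>u. u \<in> V \<Longrightarrow> a u > 0"
    and W: "W = V \<and> (\<forall>u\<in>V. b u > 0) \<or> W = V \<inter> {u. C u = c} \<and> (\<forall>u\<in>V. b u = 0)"
  shows "orbitally_phase_asymptotically_stable (X a b) W \<gamma> T"
proof -
  obtain \<rho> \<kappa> where "\<rho> > 0" "\<kappa> > 0" and V: "{u. infdist u \<Gamma> \<le> \<rho>} \<subseteq> V"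
    and \<kappa>: "\<And>u. infdist u \<Gamma> \<le> \<rho> \<Longrightarrow> infdist u \<Gamma> \<le> \<kappa> * (\<bar>H u - h\<bar> + \<bar>C u - c\<bar>)"
    by (rule infdist_le_level) blast
  let ?K = "{u. infdist u \<Gamma> \<le> \<rho>}"
  let ?F = "\<lambda>u. \<kappa> * (\<bar>H u - h\<bar> + \<bar>C u - c\<bar>)"
  have K: "compact ?K"
    using \<open>\<rho> > 0\<close> by (rule compact_tube)
  obtain m1 where "m1 > 0" and m1: "\<And>u. u \<in> ?K \<Longrightarrow> m1 \<le> a u * N u"
    by (rule compact_positive_lower_bound [OF K continuous_rate [OF K V lip(1) [OF K V]]])
      (use V pos rate_pos in \<open>auto intro!: mult_pos_pos\<close>)
  \<comment> \<open>On the level set there is no rate for \<open>C - c\<close>; the value 1 is then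
    a filler, so that \<open>\<mu>\<close> can be a minimum of two positive numbers.\<close>
  have "\<exists>m2>0. (\<forall>u\<in>?K. m2 \<le> b u * N u) \<or> W = V \<inter> {u. C u = c} \<and> (\<forall>u\<in>V. b u = 0)"
    using W
  proof
    assume W: "W = V \<and> (\<forall>u\<in>V. b u > 0)"
    obtain m where "m > 0" "\<And>u. u \<in> ?K \<Longrightarrow> m \<le> b u * N u"
      by (rule compact_positive_lower_bound [OF K continuous_rate [OF K V lip(2) [OF K V]]])
        (use V W rate_pos in \<open>auto intro!: mult_pos_pos\<close>)
    then show ?thesis
      by blast
  qed (auto intro: exI [of _ 1])
  then obtain m2 where "m2 > 0" and m2:
    "(\<forall>u\<in>?K. m2 \<le> b u * N u) \<or> W = V \<inter> {u. C u = c} \<and> (\<forall>u\<in>V. b u = 0)"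
    by blast
  define \<mu> where "\<mu> = min m1 m2"
  have "\<mu> > 0"
    using \<open>m1 > 0\<close> \<open>m2 > 0\<close> by (simp add: \<mu>_def)
  obtain L where L: "L-lipschitz_on ?K (X a b)"
    using lipschitzian_X [OF K V lip(1) [OF K V] lip(2) [OF K V]] by blast
  interpret X: periodic_orbit "X a b" \<gamma> T
    by (rule periodic_orbit_X)
  interpret attracting_orbit "X a b" \<gamma> T W ?F \<rho> L \<mu>
  proof
    show "\<rho> > 0" "\<mu> > 0" "L-lipschitz_on ?K (X a b)"
      by fact+
    show "continuous_on ?K ?F"
      by (intro continuous_intros lipschitzian_on_continuous lipschitzian_data K V)
    show "?F u = 0" if "u \<in> \<Gamma>" for u
      using that on_orbit by simp
    show "infdist u \<Gamma> \<le> ?F u" if "infdist u \<Gamma> \<le> \<rho>" for u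
      using \<kappa> [OF that] .
    fix t :: real and x
    assume t: "t \<ge> 0" and x0: "x 0 \<in> W" and x: "solution_on (X a b) ?K {0..t} x"
    have xV: "solution_on (X a b) V {0..t} x"
      by (rule solution_on_mono [OF x V]) simp
    have xK: "x s \<in> ?K" if "s \<in> {0..t}" for s
      using x that unfolding solution_on_def by blast
    have H: "\<bar>H (x t) - h\<bar> \<le> exp (- \<mu> * t) * \<bar>H (x 0) - h\<bar>"
      by (rule linear_ode_decay [OF t level_derivs(1) [OF xV]])
        (use m1 [OF xK] in \<open>force simp: \<mu>_def\<close>)+
    have C: "\<bar>C (x t) - c\<bar> \<le> exp (- \<mu> * t) * \<bar>C (x 0) - c\<bar> \<and> x t \<in> W"
      using m2
    proof
      assume m2: "\<forall>u\<in>?K. m2 \<le> b u * N u"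
      \<comment> \<open>A positive rate at \<open>x 0\<close> excludes the alternative with
        \<open>b = 0\<close>.\<close>
      have "b (x 0) * N (x 0) > 0" "x 0 \<in> V"
        using m2 xK [of 0] t \<open>m2 > 0\<close> V by (force simp: subset_iff)+
      then have "W = V"
        using W by auto
      moreover have "\<bar>C (x t) - c\<bar> \<le> exp (- \<mu> * t) * \<bar>C (x 0) - c\<bar>"
        by (rule linear_ode_decay [OF t level_derivs(2) [OF xV]])
          (use m2 xK in \<open>force simp: \<mu>_def\<close>)+
      ultimately show ?thesis
        using V xK [of t] t by auto
    next
      assume W: "W = V \<inter> {u. C u = c} \<and> (\<forall>u\<in>V. b u = 0)"
      \<comment> \<open>Rate 0: the initial value \<open>C (x 0) - c = 0\<close> persists, so the
        solution remains on the level set.\<close>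
      have "\<bar>C (x t) - c\<bar> \<le> exp (- 0 * t) * \<bar>C (x 0) - c\<bar>"
        by (rule linear_ode_decay [OF t level_derivs(2) [OF xV]]) (use W xK V in \<open>auto simp: subset_iff\<close>)
      then show ?thesis
        using W x0 V xK [of t] t by auto
    qed
    have "?F (x t) \<le> \<kappa> * (exp (- \<mu> * t) * \<bar>H (x 0) - h\<bar> + exp (- \<mu> * t) * \<bar>C (x 0) - c\<bar>)"
      using H C \<open>\<kappa> > 0\<close> by (intro mult_left_mono add_mono) auto
    then show "x t \<in> W \<and> ?F (x t) \<le> exp (- \<mu> * t) * ?F (x 0)"
      using C by (simp add: algebra_simps)
  qed
  show ?thesis
    by (rule phase_asymptotically_stable)
qed

text \<open>One negative coefficient is enough: \<open>H - h\<close> or \<open>C - c\<close> grows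
  whatever the sign of the other coefficient, which settles every change of sign.\<close>

lemma unstable:
  assumes lip: "\<And>K. compact K \<Longrightarrow> K \<subseteq> V \<Longrightarrow> lipschitzian_on K a"
      "\<And>K. compact K \<Longrightarrow> K \<subseteq> V \<Longrightarrow> lipschitzian_on K b"
    and neg: "(\<forall>u\<in>V. a u < 0) \<or> (\<forall>u\<in>V. b u < 0)"
  shows "orbitally_unstable (X a b) V \<Gamma>"
proof -
  obtain \<rho> where "\<rho> > 0" and V: "{u. infdist u \<Gamma> \<le> \<rho>} \<subseteq> V"
    by (rule tube)
  let ?K = "{u. infdist u \<Gamma> \<le> \<rho>}"
  have K: "compact ?K"
    using \<open>\<rho> > 0\<close> by (rule compact_tube)
  have near: "\<exists>u\<in>V. infdist u \<Gamma> < \<delta> \<and> f u - d \<noteq> 0"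
    if \<delta>: "\<delta> > 0" and D: "GDERIV f (\<gamma> 0) :> D" "D \<noteq> 0" for \<delta> f d D
  proof -
    have "open (V \<inter> ball (\<gamma> 0) \<delta>)" "\<gamma> 0 \<in> V \<inter> ball (\<gamma> 0) \<delta>"
      using open_V on_orbit(1) mem_orbit \<delta> by auto
    from GDERIV_nonzero_imp_nonconstant_near [OF D this, of d]
    obtain u where u: "u \<in> V" "dist (\<gamma> 0) u < \<delta>" "f u \<noteq> d"
      by auto
    moreover have "infdist u \<Gamma> < \<delta>"
      using infdist_le [OF mem_orbit [of 0], of u] u(2) by (simp add: dist_commute)
    ultimately show ?thesis
      by auto
  qed
  \<comment> \<open>Neither gradient can vanish, since their cross product does not.\<close>
  have g: "grad H (\<gamma> 0) \<noteq> 0" "grad C (\<gamma> 0) \<noteq> 0" "\<gamma> 0 \<in> V"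
    using n_nonzero [of "\<gamma> 0"] on_orbit(1) [OF mem_orbit] by auto
  show ?thesis
    unfolding orbitally_unstable_def using neg
  proof
    assume neg: "\<forall>u\<in>V. a u < 0"
    show "\<not> orbitally_stable (X a b) V \<Gamma>"
    proof (rule growing_function_unstable [OF \<open>\<rho> > 0\<close> K, where g = "\<lambda>u. H u - h" and k = "\<lambda>u. - (a u * N u)"])
      show "continuous_on ?K (\<lambda>u. H u - h)" "continuous_on ?K (\<lambda>u. - (a u * N u))"
        by (intro continuous_intros lipschitzian_on_continuous lipschitzian_data K V continuous_rate lip)+
      show "- (a u * N u) > 0" if "infdist u \<Gamma> \<le> \<rho>" for u
        using that V neg rate_pos [of u] by (auto simp: subset_iff mult_neg_pos)
      show "\<exists>u\<in>V. infdist u \<Gamma> < \<delta> \<and> H u - h \<noteq> 0" if "\<delta> > 0" for \<delta>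
        using near [OF that GDERIV_H] g by blast
    qed (rule level_derivs)
  next
    assume neg: "\<forall>u\<in>V. b u < 0"
    show "\<not> orbitally_stable (X a b) V \<Gamma>"
    proof (rule growing_function_unstable [OF \<open>\<rho> > 0\<close> K, where g = "\<lambda>u. C u - c" and k = "\<lambda>u. - (b u * N u)"])
      show "continuous_on ?K (\<lambda>u. C u - c)" "continuous_on ?K (\<lambda>u. - (b u * N u))"
        by (intro continuous_intros lipschitzian_on_continuous lipschitzian_data K V continuous_rate lip)+
      show "- (b u * N u) > 0" if "infdist u \<Gamma> \<le> \<rho>" for u
        using that V neg rate_pos [of u] by (auto simp: subset_iff mult_neg_pos)
      show "\<exists>u\<in>V. infdist u \<Gamma> < \<delta> \<and> C u - c \<noteq> 0" if "\<delta> > 0" for \<delta>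
        using near [OF that GDERIV_C] g by blast
    qed (rule level_derivs)
  qed
qed

text \<open>Invariance concerns arbitrary time intervals, backward times included, so the argument
  is constancy of \<open>C\<close> along solutions rather than a forward estimate.\<close>

lemma invariant_level:
  assumes "\<And>u. u \<in> V \<Longrightarrow> b u = 0"
  shows "dynamically_invariant (X a b) V (V \<inter> {u \<in> U. C u = c})"
  unfolding dynamically_invariant_def
proof (intro conjI allI impI)
  fix I x
  assume *: "is_interval I \<and> solution_on (X a b) V I x \<and> (\<exists>t\<in>I. x t \<in> V \<inter> {u \<in> U. C u = c})"
  then have V: "x t \<in> V" if "t \<in> I" for t
    using that by (simp add: solution_on_def)
  have "convex I"
    using * by (simp add: is_interval_convex_1)
  have "((\<lambda>t. C (x t) - c) has_field_derivative 0) (at t within I)" if "t \<in> I" for t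
    using level_derivs(2) [OF conjunct1 [OF conjunct2 [OF *]] that] by (simp add: assms V that)
  from has_field_derivative_zero_constant [OF \<open>convex I\<close> this]
  obtain d where d: "\<And>t. t \<in> I \<Longrightarrow> C (x t) - c = d"
    by blast
  obtain s where "s \<in> I" "C (x s) = c"
    using * by blast
  then have "C (x t) = c" if "t \<in> I" for t
    using d [OF that] d [of s] by simp
  then show "\<forall>t\<in>I. x t \<in> V \<inter> {u \<in> U. C u = c}"
    using V V_U by blast
qed simp

end

theorem theorem3p7:
  fixes U V :: "(real^3) set"
    and H C \<nu> :: "real^3 \<Rightarrow> real"
    and h c T :: real
    and \<gamma> :: "real \<Rightarrow> real^3"
  assumes "open U" and "open V" and "V \<subseteq> U"
    and "smooth_on U H" and "smooth_on U C" and "smooth_on U \<nu>"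
    and "functionally_independent_on V H C"
    and "periodic_solution (ham_field \<nu> H C) U \<gamma> T"
    and "orbit_of \<gamma> T \<subseteq> V"
    and "orbit_of \<gamma> T \<subseteq> {u \<in> U. (H u, C u) = (h, c)}"
    and "regular_value U (\<lambda>u. (H u, C u)) (h, c)"
  shows
    "(regular_value U C c \<longrightarrow>
       (\<forall>\<alpha>. smooth_on V \<alpha> \<and> (\<forall>u\<in>V. \<alpha> u > 0) \<longrightarrow>
         (let X = (\<lambda>u. ham_field \<nu> H C u - (\<alpha> u * (H u - h)) *\<^sub>R C_part H C u);
              M = {u \<in> U. C u = c}
          in periodic_solution X V \<gamma> T \<and>
             dynamically_invariant X V (V \<inter> M) \<and>
             orbitally_phase_asymptotically_stable X (V \<inter> M) \<gamma> T) \<and>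
         (let X = (\<lambda>u. ham_field \<nu> H C u + (\<alpha> u * (H u - h)) *\<^sub>R C_part H C u)
          in periodic_solution X V \<gamma> T \<and>
             orbitally_unstable X V (orbit_of \<gamma> T)))) \<and>
     (\<forall>\<alpha> \<beta>. smooth_on V \<alpha> \<and> smooth_on V \<beta> \<and> (\<forall>u\<in>V. \<alpha> u > 0 \<and> \<beta> u > 0) \<longrightarrow>
         (let X = (\<lambda>u. ham_field \<nu> H C u
                      - (\<alpha> u * (H u - h)) *\<^sub>R C_part H C u
                      + (\<beta> u * (C u - c)) *\<^sub>R H_part H C u)
          in periodic_solution X V \<gamma> T \<and>
             orbitally_phase_asymptotically_stable X V \<gamma> T) \<and>
         (let X = (\<lambda>u. ham_field \<nu> H C u
                      + (\<alpha> u * (H u - h)) *\<^sub>R C_part H C u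
                      + (\<beta> u * (C u - c)) *\<^sub>R H_part H C u)
          in periodic_solution X V \<gamma> T \<and>
             orbitally_unstable X V (orbit_of \<gamma> T)) \<and>
         (let X = (\<lambda>u. ham_field \<nu> H C u
                      - (\<alpha> u * (H u - h)) *\<^sub>R C_part H C u
                      - (\<beta> u * (C u - c)) *\<^sub>R H_part H C u)
          in periodic_solution X V \<gamma> T \<and>
             orbitally_unstable X V (orbit_of \<gamma> T)) \<and>
         (let X = (\<lambda>u. ham_field \<nu> H C u
                      + (\<alpha> u * (H u - h)) *\<^sub>R C_part H C u
                      - (\<beta> u * (C u - c)) *\<^sub>R H_part H C u)
          in periodic_solution X V \<gamma> T \<and>
             orbitally_unstable X V (orbit_of \<gamma> T)))"
proof -
  interpret hamiltonian_orbit U V H C \<nu> h c T \<gamma>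
    using assms(1-10) by unfold_locales
  have lip: "lipschitzian_on K f" "lipschitzian_on K (\<lambda>u. - f u)"
    if "smooth_on V f" "compact K" "K \<subseteq> V" for f :: "real^3 \<Rightarrow> real" and K
  proof -
    show "lipschitzian_on K f"
      using that Ck_on_Suc_0_imp_lipschitz [OF open_V _ that(2,3)] unfolding smooth_on_def by blast
    then show "lipschitzian_on K (\<lambda>u. - f u)"
      by simp
  qed
  \<comment> \<open>Each system of the statement is an instance of the family, with the sign changes
    moved into the coefficient functions.\<close>
  have eqs:
    "(\<lambda>u. ham_field \<nu> H C u - (\<alpha> u * (H u - h)) *\<^sub>R C_part H C u) = X \<alpha> (\<lambda>_. 0)"
    "(\<lambda>u. ham_field \<nu> H C u + (\<alpha> u * (H u - h)) *\<^sub>R C_part H C u) = X (\<lambda>u. - \<alpha> u) (\<lambda>_. 0)"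
    "(\<lambda>u. ham_field \<nu> H C u - (\<alpha> u * (H u - h)) *\<^sub>R C_part H C u + (\<beta> u * (C u - c)) *\<^sub>R H_part H C u)
      = X \<alpha> \<beta>"
    "(\<lambda>u. ham_field \<nu> H C u + (\<alpha> u * (H u - h)) *\<^sub>R C_part H C u + (\<beta> u * (C u - c)) *\<^sub>R H_part H C u)
      = X (\<lambda>u. - \<alpha> u) \<beta>"
    "(\<lambda>u. ham_field \<nu> H C u - (\<alpha> u * (H u - h)) *\<^sub>R C_part H C u - (\<beta> u * (C u - c)) *\<^sub>R H_part H C u)
      = X \<alpha> (\<lambda>u. - \<beta> u)"
    "(\<lambda>u. ham_field \<nu> H C u + (\<alpha> u * (H u - h)) *\<^sub>R C_part H C u - (\<beta> u * (C u - c)) *\<^sub>R H_part H C u)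
      = X (\<lambda>u. - \<alpha> u) (\<lambda>u. - \<beta> u)" for \<alpha> \<beta>
    by (simp_all add: perturbed_field_def fun_eq_iff)
  have level: "V \<inter> {u \<in> U. C u = c} = V \<inter> {u. C u = c}"
    using V_U by blast
  show ?thesis
    unfolding Let_def eqs
  proof (intro conjI impI allI; elim conjE)
    fix \<alpha> :: "real^3 \<Rightarrow> real"
    assume \<alpha>: "smooth_on V \<alpha>" "\<forall>u\<in>V. \<alpha> u > 0"
    show "periodic_solution (X \<alpha> (\<lambda>_. 0)) V \<gamma> T"
      by (rule periodic_X)
    show "dynamically_invariant (X \<alpha> (\<lambda>_. 0)) V (V \<inter> {u \<in> U. C u = c})"
      by (rule invariant_level) simp
    show "orbitally_phase_asymptotically_stable (X \<alpha> (\<lambda>_. 0)) (V \<inter> {u \<in> U. C u = c}) \<gamma> T"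
      unfolding level using \<alpha> lip by (intro stable) (auto intro: lipschitzian_on_const)
    show "periodic_solution (X (\<lambda>u. - \<alpha> u) (\<lambda>_. 0)) V \<gamma> T"
      by (rule periodic_X)
    show "orbitally_unstable (X (\<lambda>u. - \<alpha> u) (\<lambda>_. 0)) V \<Gamma>"
      using \<alpha> lip by (intro unstable) (auto intro: lipschitzian_on_const)
  next
    fix \<alpha> \<beta> :: "real^3 \<Rightarrow> real"
    assume \<alpha>: "smooth_on V \<alpha>" and \<beta>: "smooth_on V \<beta>" and pos: "\<forall>u\<in>V. \<alpha> u > 0 \<and> \<beta> u > 0"
    note lip = lip [OF \<alpha>] lip [OF \<beta>]
    show "periodic_solution (X \<alpha> \<beta>) V \<gamma> T" "periodic_solution (X (\<lambda>u. - \<alpha> u) \<beta>) V \<gamma> T"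
      "periodic_solution (X \<alpha> (\<lambda>u. - \<beta> u)) V \<gamma> T"
      "periodic_solution (X (\<lambda>u. - \<alpha> u) (\<lambda>u. - \<beta> u)) V \<gamma> T"
      by (rule periodic_X)+
    show "orbitally_phase_asymptotically_stable (X \<alpha> \<beta>) V \<gamma> T"
      using pos by (intro stable lip) auto
    show "orbitally_unstable (X (\<lambda>u. - \<alpha> u) \<beta>) V \<Gamma>" "orbitally_unstable (X \<alpha> (\<lambda>u. - \<beta> u)) V \<Gamma>"
      "orbitally_unstable (X (\<lambda>u. - \<alpha> u) (\<lambda>u. - \<beta> u)) V \<Gamma>"
      using pos by (intro unstable lip; simp)+
  qed
qed

end
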